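(* Let $0<|q|<1$ and let $n=1,2,3,\dots$. Then $$\vartheta_3(0,-q)^{4n(n+1)}=\left\{2^{2n^2+3n}\prod_{r=1}^{2n}(r!)^{-1}\right\}\cdot\det\left(g_{r+s-1}\right)_{1\le r,s\le n},$$ where $g_i:=G_{2i+1}-a_i$, and for $i=1,2,3,\dots$ $$G_{2i+1}\equiv G_{2i+1}(q):=\sum_{r=1}^{\infty}(-1)^{r}\frac{r^{2i+1}q^r}{1-q^r},\qquad a_i:=(-1)^{i}\frac{2^{2i+2}-1}{4(i+1)}\,|B_{2i+2}|.$$
   Context: $\vartheta_3(0,q):=\sum_{j=-\infty}^{\infty}q^{j^2}$, so $\vartheta_3(0,-q)=\sum_{j=-\infty}^{\infty}(-1)^{j}q^{j^2}$. The Bernoulli numbers $B_n$ are defined by $\frac{t}{e^t-1}=\sum_{n=0}^{\infty}B_n\frac{t^n}{n!}$, $|t|<2\pi$. *)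

theory Defs
  imports "HOL-Complex_Analysis.Complex_Analysis" "Jordan_Normal_Form.Determinant"
begin

definition theta3_0 :: "complex \<Rightarrow> complex" where
  "theta3_0 q = (\<Sum>\<^sub>\<infinity>j::int. q ^ nat (j\<^sup>2))"

text \<open>
  The Bernoulli numbers (with \<open>B\<^sub>1 = -1/2\<close>), read off from the generating function
  \<open>t / (e\<^sup>t - 1)\<close> as a formal power series; \<open>bernoulli_sums\<close> below is the analytic form of
  this identity.
\<close>
definition bernoulli :: "nat \<Rightarrow> real" where
  "bernoulli n = fact n * fps_nth (fps_X / (fps_exp 1 - 1)) n"

definition lambert_G :: "nat \<Rightarrow> complex \<Rightarrow> complex" where
  "lambert_G m q = (\<Sum>k. let r = Suc k in (-1) ^ r * (of_nat r ^ m * q ^ r / (1 - q ^ r)))"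

definition bernoulli_a :: "nat \<Rightarrow> real" where
  "bernoulli_a i =
     (-1) ^ i * ((2 ^ (2 * i + 2) - 1) / (4 * (real i + 1))) * \<bar>bernoulli (2 * i + 2)\<bar>"

definition lambert_g :: "complex \<Rightarrow> nat \<Rightarrow> complex" where
  "lambert_g q i = lambert_G (2 * i + 1) q - of_real (bernoulli_a i)"

lemma bernoulli_fps:
  "Abs_fps (\<lambda>n. of_real (bernoulli n / fact n)) = (fps_X / (fps_exp 1 - 1) :: complex fps)"
proof -
  define E where "E = (fps_exp 1 - 1 :: real fps)"
  define E' where "E' = (fps_exp 1 - 1 :: complex fps)"
  define B where "B = (fps_X / E :: real fps)"
  define C where "C = Abs_fps (\<lambda>n. complex_of_real (fps_nth B n))"
  have E1: "fps_nth E 1 \<noteq> 0" "fps_nth E' 1 \<noteq> 0" by (simp_all add: E_def E'_def)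
  then have E0: "E \<noteq> 0" "E' \<noteq> 0" by auto
  have sd: "subdegree E \<le> subdegree (fps_X :: real fps)"
    using E1 by (simp add: subdegree_leI)
  have BE: "B * E = fps_X"
    unfolding B_def using sd E0 by (simp add: fps_divide_times_eq fps_dvd_iff)
  have "C * E' = fps_X"
  proof (rule fps_ext)
    fix n
    have "fps_nth (C * E') n = of_real (fps_nth (B * E) n)"
      by (simp add: fps_mult_nth C_def E_def E'_def if_distrib [of complex_of_real]
          cong: if_cong)
    then show "fps_nth (C * E') n = fps_nth fps_X n" by (simp add: BE)
  qed
  then have "fps_X / E' = C" using E0 by (metis nonzero_mult_div_cancel_right)
  moreover have "bernoulli n / fact n = fps_nth B n" for n
    by (simp add: bernoulli_def B_def E_def)
  ultimately show ?thesis by (simp add: C_def E'_def)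
qed

lemma bernoulli_sums:
  fixes t :: complex
  assumes "norm t < 2 * pi"
  shows "(\<lambda>n. of_real (bernoulli n) * t ^ n / fact n) sums
           (if t = 0 then 1 else t / (exp t - 1))"
proof -
  define f :: "complex \<Rightarrow> complex" where "f = (\<lambda>t. if t = 0 then 1 else t / (exp t - 1))"
  define E where "E = (fps_exp 1 - 1 :: complex fps)"
  have E1: "fps_nth E 0 = 0" "fps_nth E 1 = 1" by (simp_all add: E_def)
  then have sdE: "subdegree E = 1" by (intro subdegreeI) auto
  then have E0: "E \<noteq> 0" by auto
  have expE: "(\<lambda>t::complex. exp t - 1) has_fps_expansion E"
    unfolding E_def by (intro fps_expansion_intros)
  have exp: "f has_fps_expansion fps_X / E"
    unfolding f_def
    by (rule has_fps_expansion_divide[OF has_fps_expansion_fps_X expE])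
       (use sdE E0 E1 in auto)
  have nz: "exp z \<noteq> 1" if "z \<noteq> 0" "norm z < 2 * pi" for z :: complex
  proof
    assume "exp z = 1"
    then obtain k :: int where k: "Re z = 0" "Im z = of_int (2 * k) * pi" by (auto simp: exp_eq_1)
    have "k \<noteq> 0" using k that by (auto simp: complex_eq_iff)
    then have "1 \<le> \<bar>real_of_int k\<bar>" by linarith
    then have "2 * pi \<le> \<bar>Im z\<bar>" by (simp add: k abs_mult)
    then show False using abs_Im_le_cmod[of z] that by linarith
  qed
  have hol: "f holomorphic_on ball 0 (2 * pi)"
  proof (rule no_isolated_singularity'[where K = "{0}"])
    have "isCont f 0" using has_fps_expansion_imp_continuous[OF exp, of UNIV] by simp
    then show "(f \<longlongrightarrow> f z) (at z within ball 0 (2 * pi))" if "z \<in> {0}" for z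
      using that by (auto simp: isCont_def intro: tendsto_within_subset)
    have "(\<lambda>t. t / (exp t - 1)) holomorphic_on ball 0 (2 * pi) - {0}"
      using nz by (intro holomorphic_intros) auto
    then show "f holomorphic_on ball 0 (2 * pi) - {0}"
      by (rule holomorphic_transform) (auto simp: f_def)
  qed auto
  have "(\<lambda>n. fps_nth (fps_X / E) n * t ^ n) sums f t"
    by (rule has_fps_expansion_imp_sums_complex[OF exp, of "ereal (2 * pi)"])
       (use hol assms in \<open>auto simp: eball_def ball_def dist_norm\<close>)
  then show ?thesis
    by (simp add: E_def f_def flip: bernoulli_fps)
qed

end

theory Submission
  imports Defs
begin

text \<open>
  In the multiplicative variable \<open>w = exp z\<close>, the Weierstrass function with period \<open>w \<mapsto> q w\<close> has
  a simple Lambert expansion, and the numbers \<open>2 g\<^sub>k\<close> are its even Taylor coefficients (times factorials)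
  at the half period \<open>w = -1\<close>. After subtraction of its value there, the function is \<open>c X\<close>
  with \<open>c = \<theta>\<^sup>8 / 16\<close> and \<open>X'' = 2 + 4 b X + 6 c X\<^sup>2\<close>, \<open>X(0) = X'(0) = 0\<close>.
  For such an \<open>X\<close>, the second derivative acts on the powers \<open>X\<^sup>k\<close> by a tridiagonal matrix, which
  is self-adjoint for the weights \<open>c\<^sup>k / k\<close>. This diagonalises the Hankel form, that is,
  \<open>X(x + y) - X(x - y) = X'(x) X'(y) / (1 - c X(x) X(y))\<^sup>2\<close>, and gives the determinant.
  The differential equation and the value of \<open>c\<close> both follow from the fact that a holomorphic
  function on the annulus \<open>|q| < |w| < 1/|q|\<close> which is invariant under \<open>w \<mapsto> q w\<close> is constant;
  the second one yields \<open>c\<close> as a product, which is \<open>\<theta>\<^sup>8 / 16\<close> by Gauss's identity.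
\<close>

section \<open>Hankel determinants from a quadratic differential equation\<close>

text \<open>Multiplying the equation by 2 X' and integrating gives the first integral X'^2 =
  \<open>R\<close>; the initial values fix the constant of integration as 0. Hence (X^(k+1))'' =
  (k+1) (X'' X^k + k X'^2 X^(k-1)) is again a combination of powers of X.\<close>

lemma fps_deriv2_power:
  fixes X :: "'a::field_char_0 fps"
  assumes X0: "fps_nth X 0 = 0" "fps_nth X 1 = 0"
    and ode: "fps_deriv (fps_deriv X) = 2 + fps_const (4 * b) * X + fps_const (6 * c) * X\<^sup>2"
  shows "fps_deriv (fps_deriv (X ^ Suc k)) =
           fps_const (2 * of_nat (Suc k) * (2 * of_nat k + 1)) * X ^ k
           + fps_const (4 * b * of_nat (Suc k) ^ 2) * X ^ Suc k
           + fps_const (2 * of_nat (Suc k) * (2 * of_nat k + 3) * c) * X ^ Suc (Suc k)"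
proof -
  define R where "R = 4 * X + fps_const (4 * b) * X\<^sup>2 + fps_const (4 * c) * X ^ 3"
  have dR: "fps_deriv R = 2 * fps_deriv X * fps_deriv (fps_deriv X)"
    unfolding R_def ode
    by (simp add: fps_deriv_power power2_eq_square algebra_simps numeral_fps_const)
  have "fps_deriv ((fps_deriv X)\<^sup>2) = fps_deriv R"
    unfolding dR by (simp add: power2_eq_square algebra_simps)
  moreover have "fps_nth ((fps_deriv X)\<^sup>2) 0 = fps_nth R 0"
    using X0 by (simp add: R_def power2_eq_square power3_eq_cube)
  ultimately have sq: "(fps_deriv X)\<^sup>2 = R"
    by (subst (asm) fps_deriv_eq_iff) simp
  have dpow: "fps_deriv (X ^ Suc j) = of_nat (Suc j) * fps_deriv X * X ^ j" for j
  proof (induction j)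
    case (Suc j)
    have "fps_deriv (X ^ Suc (Suc j)) = fps_deriv X * X ^ Suc j + X * fps_deriv (X ^ Suc j)"
      by (simp add: algebra_simps)
    then show ?case unfolding Suc.IH by (simp add: algebra_simps)
  qed simp
  show ?thesis
  proof (cases k)
    case 0
    then show ?thesis
      using ode by (simp add: numeral_fps_const power2_eq_square)
  next
    case (Suc j)
    have "fps_deriv (fps_deriv (X ^ Suc k)) =
        of_nat (Suc k) * (fps_deriv (fps_deriv X) * X ^ k + of_nat k * (fps_deriv X)\<^sup>2 * X ^ j)"
      unfolding dpow
      by (simp add: Suc dpow power2_eq_square algebra_simps del: power_Suc of_nat_Suc)
    then show ?thesis
      unfolding sq ode R_def Suc
      apply (simp add: algebra_simps power2_eq_square power3_eq_cube flip: fps_const_mult fps_const_add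
         numeral_fps_const fps_of_nat)
      done
  qed
qed

text \<open>X vanishes to order at least 2, so X^k vanishes to order at least 2k. This makes the
  factors of the Hankel matrix triangular.\<close>

lemma fps_nth_power_eq_0:
  fixes X :: "'a::field_char_0 fps"
  assumes X0: "fps_nth X 0 = 0" "fps_nth X 1 = 0" and "m < 2 * k"
  shows "fps_nth (X ^ k) m = 0"
proof -
  have "X = fps_X ^ 2 * fps_shift 2 X"
    using X0 by (intro fps_ext) (auto simp: fps_X_power_mult_nth not_less less_2_cases_iff simp flip: Suc_diff_le)
  then have "X ^ k = fps_X ^ (2 * k) * fps_shift 2 X ^ k"
    by (metis power_mult power_mult_distrib)
  then show ?thesis
    using assms by (simp add: fps_X_power_mult_nth)
qed

lemma fps_nth_power_double:
  fixes X :: "'a::field_char_0 fps"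
  assumes X0: "fps_nth X 0 = 0" "fps_nth X 1 = 0"
  shows "fps_nth (X ^ k) (2 * k) = fps_nth X 2 ^ k"
proof -
  have "X = fps_X ^ 2 * fps_shift 2 X"
    using X0 by (intro fps_ext) (auto simp: fps_X_power_mult_nth not_less less_2_cases_iff simp flip: Suc_diff_le)
  then have "X ^ k = fps_X ^ (2 * k) * fps_shift 2 X ^ k"
    by (metis power_mult power_mult_distrib)
  then show ?thesis
    using assms by (simp add: fps_X_power_mult_nth fps_power_zeroth numeral_2_eq_2)
qed

lemma fps_nth_deriv2: "fact n * fps_nth (fps_deriv (fps_deriv f)) n = fact (n + 2) * fps_nth f (n + 2)"
  for f :: "'a::field_char_0 fps"
  by (simp add: algebra_simps)

text \<open>The derivative of order 2a of X^k at 0. With the factorial included, differentiating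
  twice just shifts \<open>a\<close> by one.\<close>

definition taylor_power :: "'a::field_char_0 fps \<Rightarrow> nat \<Rightarrow> nat \<Rightarrow> 'a" where
  "taylor_power X a k = fact (2 * a) * fps_nth (X ^ k) (2 * a)"

lemma taylor_power_Suc:
  fixes X :: "'a::field_char_0 fps"
  assumes X0: "fps_nth X 0 = 0" "fps_nth X 1 = 0"
    and ode: "fps_deriv (fps_deriv X) = 2 + fps_const (4 * b) * X + fps_const (6 * c) * X\<^sup>2"
  shows "taylor_power X (Suc a) (Suc k) =
           2 * of_nat (Suc k) * (2 * of_nat k + 1) * taylor_power X a k
           + 4 * b * of_nat (Suc k) ^ 2 * taylor_power X a (Suc k)
           + 2 * of_nat (Suc k) * (2 * of_nat k + 3) * c * taylor_power X a (Suc (Suc k))"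
proof -
  have "taylor_power X (Suc a) (Suc k) = fact (2 * a + 2) * fps_nth (X ^ Suc k) (2 * a + 2)"
    by (simp add: taylor_power_def del: power_Suc)
  also have "\<dots> = fact (2 * a) * fps_nth (fps_deriv (fps_deriv (X ^ Suc k))) (2 * a)"
    by (rule fps_nth_deriv2 [symmetric])
  finally show ?thesis
    unfolding fps_deriv2_power [OF assms] taylor_power_def fps_add_nth fps_mult_left_const_nth
    by (simp only: algebra_simps)
qed

text \<open>
  The weights make the tridiagonal action of the second derivative on the powers of \<open>X\<close>
  self-adjoint, so that an index can be moved from one factor to the other.
\<close>
lemma hankel_factorization:
  fixes X :: "'a::field_char_0 fps"
  assumes X0: "fps_nth X 0 = 0" "fps_nth X 1 = 0"
    and ode: "fps_deriv (fps_deriv X) = 2 + fps_const (4 * b) * X + fps_const (6 * c) * X\<^sup>2"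
  shows "i + j < N \<Longrightarrow> fact (2 * (i + j + 1)) * fps_nth X (2 * (i + j + 1)) =
    (\<Sum>k<N. c ^ k / (2 * of_nat (Suc k)) * taylor_power X (Suc i) (Suc k) * taylor_power X (Suc j) (Suc k))"
proof (induction j arbitrary: i)
  case 0
  have "fps_nth (fps_deriv (fps_deriv X)) 0 = 2"
    using X0 unfolding ode by (simp add: power2_eq_square)
  then have X2: "fps_nth X 2 = 1" by (simp add: numeral_2_eq_2)
  \<comment> \<open>X^(k+1) vanishes to order 2k+2, so only k = 0 survives; its value 2 cancels the
    weight 1/2.\<close>
  have "taylor_power X (Suc 0) (Suc k) = (if k = 0 then 2 else 0)" for k
    using X2 fps_nth_power_eq_0 [OF X0, of 2 "Suc k"] by (auto simp: taylor_power_def)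
  then have "(\<Sum>k<N. c ^ k / (2 * of_nat (Suc k)) * taylor_power X (Suc i) (Suc k) * taylor_power X (Suc 0) (Suc k))
     = (\<Sum>k<N. if k = 0 then taylor_power X (Suc i) (Suc 0) else 0)"
    by (intro sum.cong) auto
  then show ?case
    using 0 by (simp add: taylor_power_def del: fact_Suc)
next
  case (Suc j)
  define t where "t = taylor_power X"
  define w where "w k = c ^ k / (2 * of_nat (Suc k))" for k
  \<comment> \<open>Boundary term of a summation by parts: in the difference of the two weighted
    sums the diagonal contributions cancel and the off-diagonal ones telescope.\<close>
  define D where "D k = of_nat (2 * k + 1) * c ^ k * (t (Suc i) (Suc k) * t (Suc j) k - t (Suc i) k * t (Suc j) (Suc k))" for k
  have "fact (2 * (i + Suc j + 1)) * fps_nth X (2 * (i + Suc j + 1)) =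
     (\<Sum>k<N. w k * t (Suc (Suc i)) (Suc k) * t (Suc j) (Suc k))"
    using Suc.IH [of "Suc i"] Suc.prems by (simp add: t_def w_def)
  also have "\<dots> = (\<Sum>k<N. w k * t (Suc i) (Suc k) * t (Suc (Suc j)) (Suc k) + (D (Suc k) - D k))"
  proof (rule sum.cong [OF refl])
    fix k
    have ne: "of_nat (Suc k) \<noteq> (0::'a)" by (simp del: of_nat_Suc)
    have w1: "w k * (2 * of_nat (Suc k) * (2 * of_nat k + 1)) = of_nat (2 * k + 1) * c ^ k"
      using ne by (simp add: w_def field_simps del: of_nat_Suc) (simp add: algebra_simps)
    have w2: "w k * (2 * of_nat (Suc k) * (2 * of_nat k + 3) * c) = of_nat (2 * Suc k + 1) * c ^ Suc k"
      using ne by (simp add: w_def field_simps del: of_nat_Suc) (simp add: algebra_simps)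
    have r: "w k * t (Suc (Suc m)) (Suc k) = of_nat (2 * k + 1) * c ^ k * t (Suc m) k
        + w k * (4 * b * of_nat (Suc k) ^ 2) * t (Suc m) (Suc k)
        + of_nat (2 * Suc k + 1) * c ^ Suc k * t (Suc m) (Suc (Suc k))" for m
      unfolding t_def taylor_power_Suc [OF assms, of "Suc m" k] w1 [symmetric] w2 [symmetric]
      by (simp only: algebra_simps)
    have "w k * t (Suc i) (Suc k) * t (Suc (Suc j)) (Suc k) = t (Suc i) (Suc k) * (w k * t (Suc (Suc j)) (Suc k))"
      by (simp only: mult_ac)
    then show "w k * t (Suc (Suc i)) (Suc k) * t (Suc j) (Suc k) =
        w k * t (Suc i) (Suc k) * t (Suc (Suc j)) (Suc k) + (D (Suc k) - D k)"
      unfolding r D_def by (simp only: algebra_simps)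
  qed
  also have "\<dots> = (\<Sum>k<N. w k * t (Suc i) (Suc k) * t (Suc (Suc j)) (Suc k)) + (D N - D 0)"
    by (simp add: sum.distrib sum_lessThan_telescope del: sum_subtractf)
  \<comment> \<open>At the lower end X^0 = 1 has no higher derivatives; at the upper end X^(N+1)
    vanishes to order beyond 2(i+1) and 2(j+1).\<close>
  also have "D 0 = 0" by (simp add: D_def t_def taylor_power_def)
  also have "D N = 0"
  proof -
    have "t (Suc i) (Suc N) = 0" "t (Suc j) (Suc N) = 0"
      using Suc.prems fps_nth_power_eq_0 [OF X0, of _ "Suc N"]
      by (auto simp: t_def taylor_power_def simp del: power_Suc mult_Suc_right)
    then show ?thesis by (simp add: D_def)
  qed
  finally show ?case by (simp add: t_def w_def)
qed

text \<open>The factorization is a product of a lower and an upper triangular matrix. Their diagonal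
  entries (2k+2)! and c^k (2k+1)! multiply, over k < n, to all factorials up to (2n)! and to c with
  exponent 0 + ... + (n-1).\<close>

lemma hankel_det_taylor:
  fixes X :: "'a::field_char_0 fps"
  assumes X0: "fps_nth X 0 = 0" "fps_nth X 1 = 0"
    and ode: "fps_deriv (fps_deriv X) = 2 + fps_const (4 * b) * X + fps_const (6 * c) * X\<^sup>2"
  shows "Determinant.det (Matrix.mat n n (\<lambda>(i, j). fact (2 * (i + j + 1)) * fps_nth X (2 * (i + j + 1)))) =
           (\<Prod>r = 1..2 * n. fact r) * c ^ (n * (n - 1) div 2)"
proof -
  define t where "t = taylor_power X"
  define L where "L = Matrix.mat n n (\<lambda>(i, k). t (Suc i) (Suc k))"
  define U where "U = Matrix.mat n n (\<lambda>(k, j). c ^ k / (2 * of_nat (Suc k)) * t (Suc j) (Suc k))"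
  have "fps_nth (fps_deriv (fps_deriv X)) 0 = 2"
    using X0 unfolding ode by (simp add: power2_eq_square)
  then have X2: "fps_nth X 2 = 1" by (simp add: numeral_2_eq_2)
  have t0: "t (Suc i) (Suc k) = 0" if "i < k" for i k
    using that fps_nth_power_eq_0 [OF X0, of _ "Suc k"]
    by (auto simp: t_def taylor_power_def simp del: power_Suc mult_Suc_right)
  have td: "t (Suc i) (Suc i) = fact (2 * Suc i)" for i
    using X2 fps_nth_power_double [OF X0, of "Suc i"]
    by (simp add: t_def taylor_power_def del: power_Suc mult_Suc_right fact_Suc)
  have "Matrix.mat n n (\<lambda>(i, j). fact (2 * (i + j + 1)) * fps_nth X (2 * (i + j + 1))) = L * U"
  proof (rule eq_matI)
    fix i j assume "i < dim_row (L * U)" "j < dim_col (L * U)"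
    then have ij: "i < n" "j < n" by (auto simp: L_def U_def)
    \<comment> \<open>This upper limit exceeds i + j, as the factorization demands, and also n; the
      terms with k >= n vanish because i < k.\<close>
    have "fact (2 * (i + j + 1)) * fps_nth X (2 * (i + j + 1)) =
       (\<Sum>k<i + j + n + 1. c ^ k / (2 * of_nat (Suc k)) * t (Suc i) (Suc k) * t (Suc j) (Suc k))"
      unfolding t_def by (rule hankel_factorization [OF assms]) simp
    also have "\<dots> = (\<Sum>k<n. c ^ k / (2 * of_nat (Suc k)) * t (Suc i) (Suc k) * t (Suc j) (Suc k))"
      using ij by (intro sum.mono_neutral_right) (auto simp: t0)
    also have "\<dots> = (L * U) $$ (i, j)"
      using ij by (simp add: L_def U_def scalar_prod_def lessThan_atLeast0 mult_ac)
    finally show "Matrix.mat n n (\<lambda>(i, j). fact (2 * (i + j + 1)) * fps_nth X (2 * (i + j + 1))) $$ (i, j) = (L * U) $$ (i, j)"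
      using ij by simp
  qed (auto simp: L_def U_def)
  moreover have "Determinant.det (L * U) = Determinant.det L * Determinant.det U"
    by (rule det_mult [of _ n]) (auto simp: L_def U_def)
  moreover have "Determinant.det L = prod_list (diag_mat L)"
    by (rule det_lower_triangular [of n]) (auto simp: L_def t0)
  moreover have "Determinant.det U = prod_list (diag_mat U)"
    by (rule det_upper_triangular [of _ n]) (auto simp: U_def upper_triangular_def t0)
  ultimately have "Determinant.det (Matrix.mat n n (\<lambda>(i, j). fact (2 * (i + j + 1)) * fps_nth X (2 * (i + j + 1)))) =
      (\<Prod>k<n. t (Suc k) (Suc k) * (c ^ k / (2 * of_nat (Suc k)) * t (Suc k) (Suc k)))"
    unfolding prod.distrib [symmetric]
    by (simp add: prod_list_diag_prod L_def U_def lessThan_atLeast0 flip: prod.distrib)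
  also have "\<dots> = (\<Prod>r = 1..2 * n. fact r) * c ^ (n * (n - 1) div 2)"
  proof (induction n)
    case (Suc n)
    have "of_nat (Suc n) \<noteq> (0::'a)" by (simp del: of_nat_Suc)
    then have *: "fact (2 * Suc n) / (2 * of_nat (Suc n)) = (fact (2 * n + 1) :: 'a)"
      by (simp add: field_simps del: of_nat_Suc) (simp add: algebra_simps)
    have "t (Suc n) (Suc n) * (c ^ n / (2 * of_nat (Suc n)) * t (Suc n) (Suc n))
       = fact (2 * n + 2) * (fact (2 * Suc n) / (2 * of_nat (Suc n))) * c ^ n"
      unfolding td by (simp add: field_simps)
    also have "\<dots> = fact (2 * n + 1) * fact (2 * n + 2) * c ^ n"
      unfolding * by (simp only: mult_ac)
    finally have s: "t (Suc n) (Suc n) * (c ^ n / (2 * of_nat (Suc n)) * t (Suc n) (Suc n)) = \<dots>" .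
    have p: "(\<Prod>r = 1..2 * Suc n. fact r :: 'a) = (\<Prod>r = 1..2 * n. fact r) * (fact (2 * n + 1) * fact (2 * n + 2))"
      by (simp add: mult_ac del: fact_Suc)
    have "Suc n * (Suc n - 1) = n * (n - 1) + n * 2" by (cases n) simp_all
    then have e: "Suc n * (Suc n - 1) div 2 = n * (n - 1) div 2 + n" by simp
    show ?case
      unfolding prod.lessThan_Suc Suc.IH s p e power_add by (simp only: mult_ac)
  qed auto
  finally show ?thesis .
qed

section \<open>Lambert series on the annulus\<close>

text \<open>The difference quotient at \<open>a\<close> has a removable singularity; it is formed
  twice.\<close>

lemma double_zero_factor:
  assumes N: "N holomorphic_on S" and S: "open S" and a: "a \<in> S"
    and N0: "N a = 0" and N1: "(N has_field_derivative 0) (at a)"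
  obtains M where "M holomorphic_on S" "\<And>w. w \<in> S \<Longrightarrow> N w = (w - a)\<^sup>2 * M w"
proof -
  define N' where "N' z = (if z = a then deriv N a else (N z - N a) / (z - a))" for z
  define M where "M z = (if z = a then deriv N' a else (N' z - N' a) / (z - a))" for z
  have "N' holomorphic_on S"
    unfolding N'_def by (rule pole_lemma_open [OF N S])
  then have "M holomorphic_on S"
    unfolding M_def by (rule pole_lemma_open [OF _ S])
  moreover have "N' a = 0"
    using N1 by (simp add: N'_def DERIV_imp_deriv)
  then have "N w = (w - a)\<^sup>2 * M w" for w
    using N0 by (simp add: M_def N'_def power2_eq_square)
  ultimately show ?thesis using that by blast
qed

text \<open>Every value is attained on the compact annulus \<open>\<surd>|q| \<le> |w| \<le> 1/\<surd>|q|\<close>, so the maximum modulus is attained.\<close>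
lemma multiplicatively_periodic_constant:
  fixes q :: complex
  assumes q: "0 < norm q" "norm q < 1"
    and hol: "f holomorphic_on {w. norm q < norm w \<and> norm w < 1 / norm q}"
    and per: "\<And>w. 1 < norm w \<Longrightarrow> norm w < 1 / norm q \<Longrightarrow> f (q * w) = f w"
  obtains c where "\<And>w. norm q < norm w \<Longrightarrow> norm w < 1 / norm q \<Longrightarrow> f w = c"
proof -
  define R :: "complex set" where "R = {w. norm q < norm w \<and> norm w < 1 / norm q}"
  define s where "s = sqrt (norm q)"
  have s: "0 < s" "s < 1" "s * s = norm q" "norm q < s"
    using q real_sqrt_gt_0_iff [of "norm q"]
    by (auto simp: s_def real_less_rsqrt power2_eq_square real_sqrt_less_iff)
  define C where "C = cball 0 (1 / s) - ball (0::complex) s"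
  have CR: "C \<subseteq> R"
  proof
    fix w assume "w \<in> C"
    then have "s \<le> norm w" "norm w \<le> 1 / s" by (auto simp: C_def)
    moreover have "1 / s < 1 / norm q" using divide_strict_left_mono [OF s(4) _ mult_pos_pos [OF s(1) q(1)], of 1] by simp
    ultimately show "w \<in> R" using s by (simp add: R_def)
  qed
  have "compact C" unfolding C_def by (intro compact_diff) auto
  moreover have "1 \<in> C" using s by (auto simp: C_def)
  moreover have "continuous_on C (\<lambda>w. norm (f w))"
    using hol CR unfolding R_def
    by (intro continuous_on_norm) (meson continuous_on_subset holomorphic_on_imp_continuous_on)
  ultimately obtain \<xi> where \<xi>: "\<xi> \<in> C" "\<And>w. w \<in> C \<Longrightarrow> norm (f w) \<le> norm (f \<xi>)"
    using continuous_attains_sup [of C "\<lambda>w. norm (f w)"] by blast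
  have le: "norm (f w) \<le> norm (f \<xi>)" if w: "w \<in> R" for w
  proof -
    \<comment> \<open>Multiplication by q carries the outer shell into \<open>C\<close>, and
      division by q carries the inner shell there.\<close>
    consider "w \<in> C" | "norm w > 1 / s" | "norm w < s" by (force simp: C_def)
    then show ?thesis
    proof cases
      case 2
      have "1 < 1 / s" using s by simp
      then have "1 < norm w" using 2 by linarith
      have e: "norm (q * w) = s * (s * norm w)" using s by (simp add: norm_mult)
      have "norm (q * w) < 1" using w q by (simp add: R_def norm_mult field_simps)
      then have "norm (q * w) \<le> 1 / s" using \<open>1 < 1 / s\<close> by linarith
      moreover have "1 < s * norm w" using 2 s by (simp add: field_simps)
      then have "s \<le> norm (q * w)" unfolding e using s mult_left_mono [of 1 "s * norm w" s] by simp
      ultimately have "q * w \<in> C" by (simp add: C_def)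
      from \<xi>(2) [OF this] show ?thesis using per [of w] \<open>1 < norm w\<close> w by (simp add: R_def)
    next
      case 3
      define v where "v = w / q"
      have qv: "q * v = w" using q by (auto simp: v_def)
      have nv: "norm v = norm w / norm q" by (simp add: v_def norm_divide)
      have v1: "1 < norm v" using w q by (simp add: nv R_def)
      have v2: "norm v < 1 / s" using 3 s q by (simp add: nv flip: s(3)) (simp add: field_simps)
      have "v \<in> C" using v1 v2 s by (simp add: C_def)
      moreover from this have "v \<in> R" using CR by blast
      ultimately show ?thesis using per [of v] v1 \<xi> by (simp add: R_def qv)
    qed (use \<xi> in blast)
  qed
  have oR: "open R" unfolding R_def
    by (intro open_Collect_conj open_Collect_less continuous_intros)
  have cR: "connected R"
    using connected_annulus(1) [where 'N = complex, of "norm q" 0 "1 / norm q"] by (simp add: R_def)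
  have "f constant_on R"
    by (rule maximum_modulus_principle [OF _ oR cR oR order_refl, of _ \<xi>])
       (use hol le \<xi>(1) CR in \<open>auto simp: R_def\<close>)
  then show ?thesis using that unfolding constant_on_def R_def by blast
qed

section \<open>Power series inside the unit disc and the rational function with the double pole at w
  = 1\<close>

lemma summable_power_powser:
  fixes z :: complex
  assumes "norm z < 1"
  shows "summable (\<lambda>r. of_nat r ^ k * z ^ r)"
  using assms
proof (induction k arbitrary: z)
  case 0
  then show ?case by (simp add: summable_geometric)
next
  case (Suc k)
  \<comment> \<open>Termwise differentiation followed by multiplication by z raises the exponent k
    by one.\<close>
  have "summable (\<lambda>n. diffs (\<lambda>r. of_nat r ^ k) n * z ^ n)"
    by (rule termdiff_converges [OF Suc.prems Suc.IH])
  from diffs_equiv [OF this] have "summable (\<lambda>n. of_nat n * of_nat n ^ k * z ^ (n - Suc 0) * z)"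
    by (intro summable_mult2) (auto simp: sums_iff)
  moreover have "of_nat n * of_nat n ^ k * z ^ (n - Suc 0) * z = of_nat n ^ Suc k * z ^ n" for n
    by (cases n) auto
  ultimately show ?case by simp
qed

text \<open>The logarithm series; the convention 1/0 = 0 removes the term r = 0.\<close>

lemma ln_powser_sums:
  fixes z :: complex
  assumes "norm z < 1"
  shows "(\<lambda>r. 1 / of_nat r * z ^ r) sums (- ln (1 - z))"
proof -
  have "(\<lambda>n. - ((- 1) ^ Suc n / of_nat n * (- z) ^ n)) sums (- ln (1 + (- z)))"
    by (intro sums_minus Ln_series) (use assms in auto)
  moreover have "(\<lambda>n. - ((- 1) ^ Suc n / of_nat n * (- z) ^ n)) = (\<lambda>n. 1 / of_nat n * z ^ n)"
  proof
    fix n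
    show "- ((- 1) ^ Suc n / of_nat n * (- z) ^ n) = 1 / of_nat n * z ^ n"
      by (cases "even n") simp_all
  qed
  ultimately show ?thesis by simp
qed

text \<open>The function w / (1 - w)^2 is the polar part of \<open>wp\<close>. Derivatives are
  written as a quotient by w because the natural operator is w d/dw, which is d/dz for w = exp
  z.\<close>

lemma has_derivative_koebe:
  assumes "w \<noteq> 0" "1 - w \<noteq> (0::complex)"
  shows "((\<lambda>w. w / (1 - w)\<^sup>2)
    has_field_derivative w * (1 + w) / (1 - w) ^ 3 / w) (at w)"
proof -
  define y where "y = 1 - w"
  have y: "y \<noteq> 0" using assms by (simp add: y_def)
  have "((\<lambda>w. w / (1 - w)\<^sup>2) has_field_derivative (1 * (1 - w)\<^sup>2 - w * (2 * (1 - w) * - 1)) / ((1 - w)\<^sup>2 * (1 - w)\<^sup>2)) (at w)"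
    using assms(2) by (auto intro!: derivative_eq_intros)
  moreover have "1 * (1 - w)\<^sup>2 - w * (2 * (1 - w) * - 1) = y * (1 + w)"
    by (simp add: y_def algebra_simps power2_eq_square)
  moreover have "y * (1 + w) / (y\<^sup>2 * y\<^sup>2) = (1 + w) / y ^ 3"
    using y by (simp add: power2_eq_square power3_eq_cube)
  ultimately show ?thesis using assms by (simp add: y_def)
qed

text \<open>With s = w / (1 - w)^2, this says s'' = s + 6 s^2 in the variable z: the trigonometric
  degeneration of the Weierstrass equation.\<close>

lemma has_derivative_koebe1:
  assumes "w \<noteq> 0" "1 - w \<noteq> (0::complex)"
  shows "((\<lambda>w. w * (1 + w) / (1 - w) ^ 3)
    has_field_derivative (w / (1 - w)\<^sup>2 + 6 * (w / (1 - w)\<^sup>2)\<^sup>2) / w) (at w)"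
proof -
  define y where "y = 1 - w"
  have y: "y \<noteq> 0" using assms by (simp add: y_def)
  have "((\<lambda>w. w * (1 + w) / (1 - w) ^ 3) has_field_derivative ((1 + 2 * w) * (1 - w) ^ 3 - w * (1 + w) * (3 * (1 - w)\<^sup>2 * - 1)) / ((1 - w) ^ 3 * (1 - w) ^ 3)) (at w)"
    using assms(2) by (auto intro!: derivative_eq_intros)
  moreover have "(1 + 2 * w) * (1 - w) ^ 3 - w * (1 + w) * (3 * (1 - w)\<^sup>2 * - 1) = y\<^sup>2 * (y\<^sup>2 + 6 * w)"
    by (simp add: y_def algebra_simps power2_eq_square power3_eq_cube)
  moreover have "y\<^sup>2 * (y\<^sup>2 + 6 * w) / (y ^ 3 * y ^ 3) = (y\<^sup>2 + 6 * w) / (y\<^sup>2 * y\<^sup>2)"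
    using y by (simp add: power2_eq_square power3_eq_cube)
  moreover have "(w / y\<^sup>2 + 6 * (w / y\<^sup>2)\<^sup>2) / w = (y\<^sup>2 + 6 * w) / (y\<^sup>2 * y\<^sup>2)"
  proof -
    have "(w / v + 6 * (w / v)\<^sup>2) / w = (v + 6 * w) / (v * v)" if "v \<noteq> 0" for v
      using that assms(1) by (simp add: field_simps power2_eq_square)
    then show ?thesis using y by simp
  qed
  ultimately show ?thesis by (simp add: y_def)
qed

lemma koebe_inverse:
  fixes w :: complex
  assumes "w \<noteq> 0"
  shows "1 / w / (1 - 1 / w)\<^sup>2 = w / (1 - w)\<^sup>2"
proof -
  have "1 - 1 / w = - ((1 - w) / w)" using assms by (simp add: field_simps)
  then show ?thesis using assms by (simp add: power_divide power2_eq_square)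
qed

text \<open>In \<open>wp2_minus_one\<close> the hypothesis is the equality of \<open>K\<close> at 1
  and at -1; each side contributes a fourth power of a/b.\<close>

lemma eighth_power_eqI:
  fixes a b :: complex
  assumes "b \<noteq> 0" "a \<noteq> 0" "1 / 4 * ((a * a) / (b * b))\<^sup>2 = M * ((b * b) / (a * a))\<^sup>2"
  shows "M = (a / b) ^ 8 / 4"
proof -
  define x where "x = a / b"
  have "x \<noteq> 0" using assms by (simp add: x_def)
  have "(a*a)/(b*b) = x^2" "(b*b)/(a*a) = inverse (x^2)"  by (auto simp: x_def power2_eq_square)
  then have "1/4 * (x^2)^2 = M * (inverse (x^2))^2" using assms by simp
  then have "M * (inverse (x^2))^2 * (x^2)^2 = 1/4 * (x^2)^2 * (x^2)^2" by simp
  also have "M * (inverse (x^2))^2 * (x^2)^2 = M" using \<open>x \<noteq> 0\<close> by (simp add: field_simps)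
  finally show ?thesis by (simp add: x_def flip: power_mult power_add)
qed

section \<open>Lambert series for a fixed nome q: convergence, functional equation,
  derivative\<close>

locale nome =
  fixes q :: complex
  assumes q: "0 < norm q" "norm q < 1"
begin

definition annulus :: "complex set" where
  "annulus = {w. norm q < norm w \<and> norm w < 1 / norm q}"

lemma open_annulus: "open annulus"
  unfolding annulus_def by (intro open_Collect_conj open_Collect_less continuous_intros)

lemma one_less_inverse: "1 < 1 / norm q"
  using q by simp

lemma annulusD: "w \<in> annulus \<Longrightarrow> w \<noteq> 0 \<and> norm w < 1 / norm q \<and> norm (1 / w) < 1 / norm q"
  using q by (auto simp: annulus_def norm_divide intro!: divide_strict_left_mono mult_pos_pos)

lemma annulus_simps [simp]: "1 \<in> annulus" "- 1 \<in> annulus" "0 \<notin> annulus"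
  "- w \<in> annulus \<longleftrightarrow> w \<in> annulus"
  using q one_less_inverse by (auto simp: annulus_def)

text \<open>At r = 0 the denominator is 0, so the coefficient is 0 by the division convention and
  the series effectively starts at r = 1.\<close>

definition lambert_coeff :: "(nat \<Rightarrow> complex) \<Rightarrow> nat \<Rightarrow> complex" where
  "lambert_coeff a r = a r * q ^ r / (1 - q ^ r)"

definition lambert :: "(nat \<Rightarrow> complex) \<Rightarrow> complex \<Rightarrow> complex" where
  "lambert a w = (\<Sum>r. lambert_coeff a r * w ^ r)"

lemma norm_one_minus_power: "r > 0 \<Longrightarrow> 1 - norm q \<le> norm (1 - q ^ r)"
proof -
  assume "r > 0"
  then have "norm (q ^ r) \<le> norm q"
    using q power_decreasing [of 1 r "norm q"] by (simp add: norm_power)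
  then show ?thesis using norm_triangle_ineq2 [of 1 "q ^ r"] by simp
qed

lemma one_minus_power_nonzero: "r > 0 \<Longrightarrow> 1 - q ^ r \<noteq> 0"
  using norm_one_minus_power [of r] q by auto

text \<open>The factor q^r moves into the argument, where |q w| < 1, and the denominators stay at
  least 1 - |q| in modulus.\<close>

lemma summable_lambert:
  assumes a: "\<And>z. norm z < 1 \<Longrightarrow> summable (\<lambda>r. a r * z ^ r)" and w: "norm w < 1 / norm q"
  shows "summable (\<lambda>r. lambert_coeff a r * w ^ r)"
proof -
  have "norm (q * w) < 1" using w q by (simp add: norm_mult field_simps)
  then obtain \<rho> where \<rho>: "norm (q * w) < \<rho>" "\<rho> < 1" using dense by blast
  then have \<rho>0: "0 < \<rho>" using norm_ge_zero order_le_less_trans by blast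
  have "summable (\<lambda>r. norm (a r * (q * w) ^ r))"
    using powser_insidea [OF a [of "of_real \<rho>"], of "q * w"] \<rho> \<rho>0 by simp
  then have s: "summable (\<lambda>r. norm (a r * (q * w) ^ r) / (1 - norm q))"
    by (rule summable_divide)
  show ?thesis
  proof (rule summable_comparison_test' [OF s, of 1])
    fix r :: nat assume "1 \<le> r"
    then have "1 - norm q \<le> norm (1 - q ^ r)" by (intro norm_one_minus_power) simp
    then have "norm (a r * (q * w) ^ r) / norm (1 - q ^ r) \<le> norm (a r * (q * w) ^ r) / (1 - norm q)"
      using q by (intro divide_left_mono mult_pos_pos) auto
    then show "norm (lambert_coeff a r * w ^ r) \<le> norm (a r * (q * w) ^ r) / (1 - norm q)"
      by (simp add: lambert_coeff_def norm_divide norm_mult norm_power power_mult_distrib)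
  qed
qed

text \<open>Termwise this is x / (1 - x) = x + x^2 / (1 - x) at x = q^r. At r = 0 the coefficient is
  0 by convention, which \<open>a 0 = 0\<close> matches.\<close>

lemma lambert_functional_eq:
  assumes a: "\<And>z. norm z < 1 \<Longrightarrow> summable (\<lambda>r. a r * z ^ r)" and w: "norm w < 1 / norm q"
    and a0: "a 0 = 0"
  shows "lambert a w = (\<Sum>r. a r * (q * w) ^ r) + lambert a (q * w)"
proof -
  have qw: "norm (q * w) < 1" using w q by (simp add: norm_mult field_simps)
  then have "norm (q * w) < 1 / norm q" using one_less_inverse by linarith
  then have "(\<Sum>r. a r * (q * w) ^ r) + lambert a (q * w) =
      (\<Sum>r. a r * (q * w) ^ r + lambert_coeff a r * (q * w) ^ r)"
    unfolding lambert_def by (intro suminf_add a qw summable_lambert)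
  also have "\<dots> = lambert a w"
    unfolding lambert_def
  proof (intro suminf_cong)
    fix r
    show "a r * (q * w) ^ r + lambert_coeff a r * (q * w) ^ r = lambert_coeff a r * w ^ r"
      using one_minus_power_nonzero [of r] a0
      by (cases "r = 0") (auto simp: lambert_coeff_def power_mult_distrib field_simps)
  qed
  finally show ?thesis ..
qed

lemma lambert_has_derivative:
  assumes a: "\<And>z. norm z < 1 \<Longrightarrow> summable (\<lambda>r. a r * z ^ r)" and w: "norm w < 1 / norm q"
    and w0: "w \<noteq> 0"
  shows "(lambert a has_field_derivative lambert (\<lambda>r. of_nat r * a r) w / w) (at w)"
proof -
  let ?c = "lambert_coeff a"
  have *: "summable (\<lambda>r. ?c r * z ^ r)" if "norm z < 1 / norm q" for z
    by (rule summable_lambert [OF a that])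
  have "summable (\<lambda>n. diffs ?c n * w ^ n)"
    by (rule termdiff_converges [OF w *])
  from diffs_equiv [OF this] have "(\<Sum>n. diffs ?c n * w ^ n) = (\<Sum>n. of_nat n * ?c n * w ^ (n - Suc 0))"
    and sm: "summable (\<lambda>n. of_nat n * ?c n * w ^ (n - Suc 0))"
    by (auto simp: sums_iff)
  moreover have "of_nat n * ?c n * w ^ n / w = of_nat n * ?c n * w ^ (n - Suc 0)" for n
    using w0 by (cases n) auto
  moreover have "lambert (\<lambda>r. of_nat r * a r) w / w = (\<Sum>n. of_nat n * ?c n * w ^ n / w)"
  proof -
    have "summable (\<lambda>n. of_nat n * ?c n * w ^ (n - Suc 0) * w)"
      using sm by (rule summable_mult2)
    moreover have "of_nat n * ?c n * w ^ (n - Suc 0) * w = of_nat n * ?c n * w ^ n" for n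
      by (cases n) auto
    ultimately have "summable (\<lambda>n. of_nat n * ?c n * w ^ n)" by simp
    from suminf_divide [OF this] show ?thesis
      by (simp add: lambert_def lambert_coeff_def mult_ac)
  qed
  ultimately have "(\<Sum>n. diffs ?c n * w ^ n) = lambert (\<lambda>r. of_nat r * a r) w / w" by simp
  with termdiffs_strong' [OF * w] show ?thesis by (simp add: lambert_def [abs_def])
qed

section \<open>The Weierstrass function in multiplicative form\<close>

text \<open>The k-th derivative in z of the part of \<open>wp\<close> that is holomorphic on the
  annulus; the sign comes from differentiating w^(-r) k times.\<close>

definition eis :: "nat \<Rightarrow> complex \<Rightarrow> complex" where
  "eis k w = lambert (\<lambda>r. of_nat r ^ Suc k) w + (- 1) ^ k * lambert (\<lambda>r. of_nat r ^ Suc k) (1 / w)"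

lemma eis_has_derivative:
  assumes w: "w \<in> annulus"
  shows "(eis k has_field_derivative eis (Suc k) w / w) (at w)"
proof -
  have d: "(lambert (\<lambda>r. of_nat r ^ Suc k) has_field_derivative lambert (\<lambda>r. of_nat r ^ Suc (Suc k)) v / v) (at v)"
    if "v \<noteq> 0" "norm v < 1 / norm q" for v
    using lambert_has_derivative [OF summable_power_powser [of _ "Suc k"] that(2,1)] by simp
  have w0: "w \<noteq> 0" using annulusD [OF w] by simp
  have "((\<lambda>w. lambert (\<lambda>r. of_nat r ^ Suc k) (1 / w)) has_field_derivative
      (lambert (\<lambda>r. of_nat r ^ Suc (Suc k)) (1 / w) / (1 / w)) * (- 1 / w\<^sup>2)) (at w)"
    by (rule DERIV_chain2 [OF d])
       (use annulusD [OF w] in \<open>auto intro!: derivative_eq_intros simp: power2_eq_square\<close>)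
  then have "(eis k has_field_derivative lambert (\<lambda>r. of_nat r ^ Suc (Suc k)) w / w
      + (- 1) ^ k * ((lambert (\<lambda>r. of_nat r ^ Suc (Suc k)) (1 / w) / (1 / w)) * (- 1 / w\<^sup>2))) (at w)"
    unfolding eis_def [abs_def]
    by (intro DERIV_add DERIV_cmult d) (use annulusD [OF w] in auto)
  then show ?thesis
    using w0 by (elim DERIV_cong) (simp add: eis_def power2_eq_square field_simps)
qed

lemma eis_holomorphic: "eis k holomorphic_on annulus"
  using eis_has_derivative open_annulus by (auto simp: holomorphic_on_open)

lemma eis_one [simp]: "odd k \<Longrightarrow> eis k 1 = 0" "odd k \<Longrightarrow> eis k (- 1) = 0"
  by (simp_all add: eis_def)

text \<open>
  \<open>wp\<close> is the Weierstrass function (up to an additive constant) in the multiplicative variable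
  \<open>w = exp z\<close>, and \<open>wp1\<close> and \<open>wp2\<close> are its first two derivatives with respect to \<open>z\<close>.
\<close>
definition wp :: "complex \<Rightarrow> complex" where
  "wp w = w / (1 - w)\<^sup>2 + eis 0 w"

definition wp1 :: "complex \<Rightarrow> complex" where
  "wp1 w = w * (1 + w) / (1 - w) ^ 3 + eis 1 w"

definition wp2 :: "complex \<Rightarrow> complex" where
  "wp2 w = w / (1 - w)\<^sup>2 + 6 * (w / (1 - w)\<^sup>2)\<^sup>2 + eis 2 w"

lemma wp_has_derivative:
  assumes w: "w \<in> annulus" "w \<noteq> 1"
  shows "(wp has_field_derivative wp1 w / w) (at w)"
proof -
  have w0: "w \<noteq> 0" "1 - w \<noteq> 0" using annulusD [OF w(1)] w by auto
  note has_derivative_koebe [OF w0]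
  from DERIV_add [OF this eis_has_derivative [OF w(1)]] show ?thesis
    unfolding wp_def [abs_def] wp1_def by (simp add: add_divide_distrib numeral_2_eq_2)
qed

lemma wp1_has_derivative:
  assumes w: "w \<in> annulus" "w \<noteq> 1"
  shows "(wp1 has_field_derivative wp2 w / w) (at w)"
proof -
  have w0: "w \<noteq> 0" "1 - w \<noteq> 0" using annulusD [OF w(1)] w by auto
  note has_derivative_koebe1 [OF w0]
  from DERIV_add [OF this eis_has_derivative [OF w(1)]] show ?thesis
    unfolding wp1_def [abs_def] wp2_def by (simp add: add_divide_distrib numeral_2_eq_2)
qed

text \<open>The functional equation combined with the sum of n x^n, which is x / (1 - x)^2, at x = q
  w.\<close>

lemma lambert_shift:
  assumes "norm w < 1 / norm q"
  shows "lambert (\<lambda>r. of_nat r ^ Suc 0) w = q * w / (1 - q * w)\<^sup>2 + lambert (\<lambda>r. of_nat r ^ Suc 0) (q * w)"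
proof -
  have qw: "norm (q * w) < 1" using assms q by (simp add: norm_mult field_simps)
  have "(\<lambda>n. q * w * (of_nat (Suc n) * (q * w) ^ n)) sums (q * w * (1 / (1 - q * w)\<^sup>2))"
    by (intro sums_mult geometric_deriv_sums qw)
  then have "(\<lambda>n. of_nat (Suc n) * (q * w) ^ Suc n) sums (q * w / (1 - q * w)\<^sup>2)"
    by (simp add: mult_ac)
  then have "(\<lambda>n. of_nat n * (q * w) ^ n) sums (q * w / (1 - q * w)\<^sup>2)"
    by (subst (asm) sums_Suc_iff) simp
  then have "(\<Sum>r. of_nat r ^ Suc 0 * (q * w) ^ r) = q * w / (1 - q * w)\<^sup>2"
    by (simp add: sums_iff)
  with lambert_functional_eq [OF summable_power_powser assms, of "Suc 0"] show ?thesis by simp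
qed

lemma shift_annulus:
  assumes w: "1 < norm w" "norm w < 1 / norm q"
  shows "w \<in> annulus" "q * w \<in> annulus" "w \<noteq> 1" "q * w \<noteq> 1" "w \<noteq> - 1" "q * w \<noteq> - 1" "w \<noteq> 0"
    "norm (1 / (q * w)) < 1 / norm q"
proof -
  have "norm q * norm w < 1" "norm q < norm q * norm w"
    using w q by (simp_all add: field_simps)
  then show "q * w \<in> annulus" "q * w \<noteq> 1" "q * w \<noteq> - 1"
    using one_less_inverse by (auto simp: annulus_def norm_mult simp flip: norm_mult)
  then show "norm (1 / (q * w)) < 1 / norm q" using annulusD by blast
qed (use w q in \<open>auto simp: annulus_def\<close>)

text \<open>Under w -> q w the first Lambert half absorbs the polar term at q w, while the second
  half releases the polar term at w.\<close>

lemma wp_periodic: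
  assumes w: "1 < norm w" "norm w < 1 / norm q"
  shows "wp (q * w) = wp w"
proof -
  have q0: "q \<noteq> 0" using q by auto
  note sh = shift_annulus [OF w]
  have "lambert (\<lambda>r. of_nat r ^ Suc 0) (1 / (q * w)) = 1 / w / (1 - 1 / w)\<^sup>2 + lambert (\<lambda>r. of_nat r ^ Suc 0) (1 / w)"
    using lambert_shift [OF sh(8)] q0 by simp
  moreover have "1 / w / (1 - 1 / w)\<^sup>2 = w / (1 - w)\<^sup>2"
    by (rule koebe_inverse [OF sh(7)])
  ultimately show ?thesis
    using lambert_shift [OF w(2)] by (simp add: wp_def eis_def)
qed

text \<open>The operator w d/dw commutes with w -> q w: the chain rule factor q cancels against the
  quotient by q w.\<close>

lemma derivative_periodic:
  assumes f: "\<And>w. w \<in> annulus \<Longrightarrow> w \<noteq> 1 \<Longrightarrow> (f has_field_derivative f1 w / w) (at w)"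
    and per: "\<And>w. 1 < norm w \<Longrightarrow> norm w < 1 / norm q \<Longrightarrow> f (q * w) = f w"
    and w: "1 < norm w" "norm w < 1 / norm q"
  shows "f1 (q * w) = f1 w"
proof -
  note sh = shift_annulus [OF w]
  have q0: "q \<noteq> 0" using q by auto
  have "((\<lambda>w. f (q * w)) has_field_derivative f1 (q * w) / (q * w) * q) (at w)"
    by (rule DERIV_chain2 [where g = "\<lambda>w. q * w", OF f [OF sh(2,4)]]) (auto intro!: derivative_eq_intros)
  moreover have "open {w. 1 < norm w \<and> norm w < 1 / norm q}"
    by (intro open_Collect_conj open_Collect_less continuous_intros)
  ultimately have "(f has_field_derivative f1 (q * w) / (q * w) * q) (at w)"
    by (rule has_field_derivative_transform_within_open) (use w per in auto)
  with f [OF sh(1,3)] have "f1 w / w = f1 (q * w) / (q * w) * q"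
    by (rule DERIV_unique)
  then show ?thesis using sh q0 by simp
qed

lemma wp1_periodic: "1 < norm w \<Longrightarrow> norm w < 1 / norm q \<Longrightarrow> wp1 (q * w) = wp1 w"
  by (rule derivative_periodic [OF wp_has_derivative wp_periodic])

lemma wp2_periodic: "1 < norm w \<Longrightarrow> norm w < 1 / norm q \<Longrightarrow> wp2 (q * w) = wp2 w"
  by (rule derivative_periodic [OF wp1_has_derivative wp1_periodic])

text \<open>A suitable combination of \<open>wp2\<close>, \<open>wp\<close> squared and
  \<open>wp\<close> loses its pole at w = 1. Its holomorphic extension \<open>H\<close> is invariant
  under w -> q w, hence constant.\<close>

lemma wp_ode:
  obtains \<beta> \<gamma> where "\<And>w. w \<in> annulus \<Longrightarrow> w \<noteq> 1 \<Longrightarrow> wp2 w = 6 * (wp w)\<^sup>2 + \<beta> * wp w + \<gamma>"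
proof -
  have "(\<lambda>w. eis 0 w - eis 0 1) holomorphic_on annulus"
    by (intro holomorphic_intros eis_holomorphic)
  moreover have "((\<lambda>w. eis 0 w - eis 0 1) has_field_derivative 0) (at 1)"
    using eis_has_derivative [of 1 0] by (auto intro!: derivative_eq_intros)
  ultimately obtain M where M: "M holomorphic_on annulus"
      "\<And>w. w \<in> annulus \<Longrightarrow> eis 0 w - eis 0 1 = (w - 1)\<^sup>2 * M w"
    using double_zero_factor [OF _ open_annulus, of "\<lambda>w. eis 0 w - eis 0 1" 1] by auto
  \<comment> \<open>With s = w / (1 - w)^2 the s^2 terms cancel, and s has coefficient 1 - 12
    \<open>eis 0 w\<close> - \<beta>. This \<beta> makes it vanish at w = 1, doubly because
    \<open>eis 1 1 = 0\<close>, which compensates the double pole of s.\<close>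
  define \<beta> where "\<beta> = 1 - 12 * eis 0 1"
  define H where "H w = eis 2 w - 6 * (eis 0 w)\<^sup>2 - \<beta> * eis 0 w - 12 * w * M w" for w
  have H: "H w = wp2 w - 6 * (wp w)\<^sup>2 - \<beta> * wp w" if "w \<in> annulus" "w \<noteq> 1" for w
  proof -
    define s where "s = w / (1 - w)\<^sup>2"
    have "w * M w = s * (eis 0 w - eis 0 1)"
      using that by (simp add: M(2) s_def power2_commute)
    then have "H w = eis 2 w - 6 * (eis 0 w)\<^sup>2 - \<beta> * eis 0 w - 12 * (s * (eis 0 w - eis 0 1))"
      by (simp add: H_def)
    also have "\<dots> = wp2 w - 6 * (wp w)\<^sup>2 - \<beta> * wp w"
      unfolding wp_def wp2_def \<beta>_def s_def [symmetric] by (simp add: power2_eq_square algebra_simps)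
    finally show ?thesis .
  qed
  have "H holomorphic_on annulus"
    unfolding H_def by (intro holomorphic_intros eis_holomorphic M)
  moreover have "H (q * w) = H w" if "1 < norm w" "norm w < 1 / norm q" for w
    using shift_annulus [OF that] H wp_periodic [OF that] wp2_periodic [OF that] by simp
  ultimately obtain \<gamma> where "\<And>w. w \<in> annulus \<Longrightarrow> H w = \<gamma>"
    using multiplicatively_periodic_constant [OF q, of H] unfolding annulus_def by blast
  then have "wp2 w = 6 * (wp w)\<^sup>2 + \<beta> * wp w + \<gamma>" if "w \<in> annulus" "w \<noteq> 1" for w
    using H [OF that] that by (simp add: algebra_simps)
  then show ?thesis using that by blast
qed

section \<open>The infinite product, its theta function, and the value of \<open>wp2\<close> at the
  half period\<close>

text \<open>This is \<open>\<Prod>r\<ge>1. 1 - q ^ r * w\<close>, written as the exponential of its logarithm.\<close>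
definition euler :: "complex \<Rightarrow> complex" where
  "euler w = exp (- lambert (\<lambda>r. 1 / of_nat r) w)"

lemma summable_ln_powser: "norm z < 1 \<Longrightarrow> summable (\<lambda>r. 1 / of_nat r * z ^ r)" for z :: complex
  using ln_powser_sums sums_summable by blast

lemma euler_nonzero [simp]: "euler w \<noteq> 0"
  by (simp add: euler_def)

lemma euler_zero [simp]: "euler 0 = 1"
  using suminf_finite [of "{}" "\<lambda>r. lambert_coeff (\<lambda>r. 1 / of_nat r) r * 0 ^ r"]
  by (simp add: euler_def lambert_def lambert_coeff_def power_0_left if_distrib cong: if_cong)

lemma euler_holomorphic: "euler holomorphic_on ball 0 (1 / norm q)"
proof -
  have "(\<lambda>w. \<Sum>r. lambert_coeff (\<lambda>r. 1 / of_nat r) r * w ^ r) field_differentiable at w" if "w \<in> ball 0 (1 / norm q)" for w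
    using termdiffs_strong' [OF summable_lambert [OF summable_ln_powser], of "1 / norm q" w] that
    by (auto simp: field_differentiable_def)
  then show ?thesis
    unfolding euler_def [abs_def] lambert_def
    by (intro holomorphic_intros) (auto simp: holomorphic_on_def intro: field_differentiable_at_within)
qed

lemma euler_shift:
  assumes "norm w < 1 / norm q"
  shows "euler w = (1 - q * w) * euler (q * w)"
proof -
  have qw: "norm (q * w) < 1" using assms q by (simp add: norm_mult field_simps)
  have "lambert (\<lambda>r. 1 / of_nat r) w = - ln (1 - q * w) + lambert (\<lambda>r. 1 / of_nat r) (q * w)"
    using lambert_functional_eq [OF summable_ln_powser assms] ln_powser_sums [OF qw] by (simp add: sums_iff)
  then have "euler w = exp (ln (1 - q * w)) * euler (q * w)"
    by (simp add: euler_def flip: exp_add)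
  moreover have "1 - q * w \<noteq> 0" using qw by auto
  ultimately show ?thesis by simp
qed

text \<open>Multiplied by 1 - w this is the Jacobi theta product, up to a constant. The factor 1 - w
  is kept apart so that \<open>theta_prod\<close> has no zeros on the annulus.\<close>

definition theta_prod :: "complex \<Rightarrow> complex" where
  "theta_prod w = euler w * euler (1 / w)"

lemma theta_prod_nonzero [simp]: "theta_prod w \<noteq> 0"
  by (simp add: theta_prod_def)

lemma theta_prod_holomorphic: "theta_prod holomorphic_on annulus"
proof -
  have "euler holomorphic_on annulus"
    by (rule holomorphic_on_subset [OF euler_holomorphic]) (use annulusD in auto)
  moreover have "(euler \<circ> (\<lambda>w. 1 / w)) holomorphic_on annulus"
    by (rule holomorphic_on_compose_gen [OF _ euler_holomorphic])
       (use annulusD in \<open>auto intro!: holomorphic_intros\<close>)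
  ultimately show ?thesis
    unfolding theta_prod_def [abs_def] by (intro holomorphic_on_mult) (simp_all add: o_def)
qed

lemma theta_prod_shift:
  assumes w: "1 < norm w" "norm w < 1 / norm q"
  shows "(1 - q * w) * theta_prod (q * w) = - ((1 - w) * theta_prod w) / w"
proof -
  note sh = shift_annulus [OF w]
  have q0: "q \<noteq> 0" using q by auto
  have "euler (1 / (q * w)) = (1 - 1 / w) * euler (1 / w)"
    using euler_shift [OF sh(8)] q0 by simp
  then have "(1 - q * w) * theta_prod (q * w) = euler w * ((1 - 1 / w) * euler (1 / w))"
    unfolding theta_prod_def euler_shift [OF w(2)] by (simp only: mult_ac)
  then show ?thesis using sh(7) by (simp add: theta_prod_def field_simps)
qed

text \<open>\<open>wp w - wp (- 1)\<close> has a double pole at 1 and a double zero at -1, like the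
  square of (1 + w) \<open>theta_prod (- w)\<close> over (1 - w) \<open>theta_prod w\<close>. Their
  quotient \<open>K\<close> is therefore holomorphic and invariant, hence constant. Comparing its
  values at 1 and -1 gives \<open>M (- 1)\<close>, and \<open>wp2 (- 1)\<close> is half of
  that.\<close>

lemma wp2_minus_one: "wp2 (- 1) = (euler 1 / euler (- 1)) ^ 8 / 8"
proof -
  define N where "N w = w + (eis 0 w - wp (- 1)) * (1 - w)\<^sup>2" for w
  have p0: "eis 0 (- 1) - wp (- 1) = 1 / 4"
    by (simp add: wp_def)
  have "N holomorphic_on annulus"
    unfolding N_def by (intro holomorphic_intros eis_holomorphic)
  moreover have "N (- 1) = 0" by (simp add: N_def p0)
  \<comment> \<open>The derivative is 1 - 4 * (1/4): the contribution of \<open>eis 1\<close>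
    vanishes at the half period.\<close>
  moreover have "(N has_field_derivative 0) (at (- 1))"
  proof -
    have "((\<lambda>w. (1 - w)\<^sup>2) has_field_derivative - 4) (at (- 1 :: complex))"
      by (auto intro!: derivative_eq_intros)
    moreover have "((\<lambda>w. eis 0 w - wp (- 1)) has_field_derivative 0) (at (- 1))"
      using eis_has_derivative [of "- 1" 0] by (auto intro!: derivative_eq_intros)
    ultimately have "((\<lambda>w. (eis 0 w - wp (- 1)) * (1 - w)\<^sup>2) has_field_derivative
        0 * (1 - (- 1))\<^sup>2 + - 4 * (eis 0 (- 1) - wp (- 1))) (at (- 1))"
      by (intro DERIV_mult)
    from DERIV_add [OF DERIV_ident this] show ?thesis
      by (simp add: N_def [abs_def] p0)
  qed
  ultimately obtain M where M: "M holomorphic_on annulus"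
      "\<And>w. w \<in> annulus \<Longrightarrow> N w = (w + 1)\<^sup>2 * M w"
    using double_zero_factor [OF _ open_annulus, of N "- 1"] by auto
  have Nwp: "N w = (wp w - wp (- 1)) * (1 - w)\<^sup>2" if "w \<noteq> 1" for w
    using that by (simp add: N_def wp_def field_simps)
  define K where "K w = M w * (theta_prod w / theta_prod (- w))\<^sup>2" for w
  have K: "K w = (wp w - wp (- 1)) * (((1 - w) * theta_prod w) / ((1 - (- w)) * theta_prod (- w)))\<^sup>2"
    if "w \<in> annulus" "w \<noteq> 1" "w \<noteq> - 1" for w
  proof -
    have "w + 1 \<noteq> 0" using that by (simp add: add_eq_0_iff2)
    then have "M w = (wp w - wp (- 1)) * (1 - w)\<^sup>2 / (1 + w)\<^sup>2"
      using M(2) [OF that(1)] Nwp [OF that(2)] by (simp add: field_simps)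
    then show ?thesis by (simp add: K_def power_mult_distrib power_divide)
  qed
  have "K holomorphic_on annulus"
    unfolding K_def
  proof -
    have "(theta_prod \<circ> uminus) holomorphic_on annulus"
      by (rule holomorphic_on_compose_gen [OF _ theta_prod_holomorphic])
         (auto intro: holomorphic_intros)
    then show "(\<lambda>w. M w * (theta_prod w / theta_prod (- w))\<^sup>2) holomorphic_on annulus"
      by (intro holomorphic_intros M theta_prod_holomorphic) (simp_all add: o_def)
  qed
  moreover have "K (q * w) = K w" if w: "1 < norm w" "norm w < 1 / norm q" for w
  proof -
    note sh = shift_annulus [OF w]
    have "(1 - q * w) * theta_prod (q * w) = - ((1 - w) * theta_prod w) / w"
      by (rule theta_prod_shift [OF w])
    moreover have "(1 - (- (q * w))) * theta_prod (- (q * w)) = ((1 - (- w)) * theta_prod (- w)) / w"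
      using theta_prod_shift [of "- w"] w by simp
    \<comment> \<open>The factors of quasi-periodicity at w and -w differ only in sign, and the
      square in \<open>K\<close> removes it.\<close>
    ultimately have "((1 - q * w) * theta_prod (q * w)) / ((1 - (- (q * w))) * theta_prod (- (q * w))) =
       - (((1 - w) * theta_prod w) / ((1 - (- w)) * theta_prod (- w)))"
      using sh(7) by (simp only:) simp
    then show ?thesis
      using K [OF sh(1,3,5)] K [OF sh(2,4,6)] wp_periodic [OF w] by (simp only: power2_minus)
  qed
  ultimately obtain c where "\<And>w. w \<in> annulus \<Longrightarrow> K w = c"
    using multiplicatively_periodic_constant [OF q, of K] unfolding annulus_def by blast
  then have "K 1 = K (- 1)" by simp
  moreover have "M 1 = 1 / 4" using M(2) [of 1] by (simp add: N_def field_simps)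
  ultimately have M1: "M (- 1) = (euler 1 / euler (- 1)) ^ 8 / 4"
    by (intro eighth_power_eqI) (simp_all add: K_def theta_prod_def)
  define G where "G w = M w / (1 - w)\<^sup>2" for w
  define V where "V = annulus - {1}"
  have V: "open V" "- 1 \<in> V" by (auto simp: V_def open_annulus)
  have G: "G holomorphic_on V"
    unfolding G_def V_def by (intro holomorphic_intros holomorphic_on_subset [OF M(1)]) auto
  have wpG: "wp w = wp (- 1) + (w + 1)\<^sup>2 * G w" if "w \<in> V" for w
    using that M(2) [of w] Nwp [of w] by (auto simp: V_def G_def field_simps)
  \<comment> \<open>Splitting one zero off \<open>wp1\<close> reduces its derivative at -1 to the
    value of \<open>h\<close> there, so only \<open>G (- 1)\<close> enters and not its
    derivative.\<close>
  define h where "h w = w * (2 * G w + (w + 1) * deriv G w)" for w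
  have h: "wp1 w = (w + 1) * h w" if "w \<in> V" for w
  proof -
    have "((\<lambda>w. wp (- 1) + (w + 1)\<^sup>2 * G w) has_field_derivative (w + 1) * (2 * G w + (w + 1) * deriv G w)) (at w)"
      by (rule derivative_eq_intros holomorphic_derivI [OF G V(1) that] refl | simp)+
         (simp add: algebra_simps power2_eq_square)
    then have "(wp has_field_derivative (w + 1) * (2 * G w + (w + 1) * deriv G w)) (at w)"
      by (rule has_field_derivative_transform_within_open [OF _ V(1) that]) (simp add: wpG)
    moreover have "(wp has_field_derivative wp1 w / w) (at w)"
      using that by (intro wp_has_derivative) (auto simp: V_def)
    ultimately have "wp1 w / w = (w + 1) * (2 * G w + (w + 1) * deriv G w)"
      by (rule DERIV_unique [rotated])
    moreover have "w \<noteq> 0" using that by (auto simp: V_def)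
    ultimately show ?thesis by (simp add: h_def field_simps)
  qed
  have "h holomorphic_on V"
    unfolding h_def by (intro holomorphic_intros G holomorphic_deriv V)
  then have "(h has_field_derivative deriv h (- 1)) (at (- 1))"
    by (rule holomorphic_derivI [OF _ V])
  then have "((\<lambda>w. (w + 1) * h w) has_field_derivative h (- 1)) (at (- 1))"
    by (auto intro!: derivative_eq_intros)
  then have "(wp1 has_field_derivative h (- 1)) (at (- 1))"
    by (rule has_field_derivative_transform_within_open [OF _ V]) (simp add: h)
  moreover have "(wp1 has_field_derivative wp2 (- 1) / (- 1)) (at (- 1))"
    by (intro wp1_has_derivative) auto
  ultimately have "wp2 (- 1) / (- 1) = h (- 1)"
    by (rule DERIV_unique [rotated])
  then show ?thesis by (simp add: h_def G_def M1)
qed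

section \<open>Gauss's product for the theta series\<close>

text \<open>The q-Pochhammer symbol (q; q)_n.\<close>

definition qpoch :: "nat \<Rightarrow> complex" where
  "qpoch n = (\<Prod>k<n. 1 - q ^ Suc k)"

lemma qpoch_0 [simp]: "qpoch 0 = 1"
  by (simp add: qpoch_def)

lemma qpoch_Suc: "qpoch (Suc n) = qpoch n * (1 - q ^ Suc n)"
  by (simp add: qpoch_def)

lemma qpoch_nonzero [simp]: "qpoch n \<noteq> 0"
  using one_minus_power_nonzero by (auto simp: qpoch_def simp del: power_Suc)

text \<open>With a = q^(d+1), b = q^(2j+d+1) and n = j + d, this is a multiple of (1 - ab) / ((1 -
  a)(1 - b)) - 1 = a / (1 - a) + b / (1 - b).\<close>

lemma gauss_summand:
  fixes d j :: nat
  shows "(1 - q ^ (2 * (j + d) + 2)) * (q ^ j\<^sup>2 / (qpoch (d + 1) * qpoch (2 * j + d + 1))) - q ^ j\<^sup>2 / (qpoch d * qpoch (2 * j + d)) =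
     q ^ j\<^sup>2 * q ^ (d + 1) / (qpoch (d + 1) * qpoch (2 * j + d)) + q ^ j\<^sup>2 * q ^ (2 * j + d + 1) / (qpoch d * qpoch (2 * j + d + 1))"
proof -
  define a b where "a = q ^ (d + 1)" and "b = q ^ (2 * j + d + 1)"
  have ab: "1 - a \<noteq> 0" "1 - b \<noteq> 0"
    using one_minus_power_nonzero [of "d + 1"] one_minus_power_nonzero [of "2 * j + d + 1"] by (simp_all add: a_def b_def)
  have e: "q ^ (2 * (j + d) + 2) = a * b"
    by (simp add: a_def b_def flip: power_add) (simp add: algebra_simps)
  have p: "qpoch (d + 1) = qpoch d * (1 - a)" "qpoch (2 * j + d + 1) = qpoch (2 * j + d) * (1 - b)"
    using qpoch_Suc [of d] qpoch_Suc [of "2 * j + d"] by (simp_all add: a_def b_def)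
  have "(1 - a * b) * (x / (u * (1 - a) * (v * (1 - b)))) - x / (u * v) = x * a / (u * (1 - a) * v) + x * b / (u * (v * (1 - b)))"
    if "u \<noteq> 0" "v \<noteq> 0" for x u v
  proof -
    define y where "y = x / (u * v)"
    have "(1 - a * b) / ((1 - a) * (1 - b)) - 1 = a / (1 - a) + b / (1 - b)"
    proof -
      have "1 - a * b = (1 - a) * (1 - b) + a * (1 - b) + b * (1 - a)" by (simp add: algebra_simps)
      then show ?thesis using ab by (simp only: add_divide_distrib) simp
    qed
    then have "y * ((1 - a * b) / ((1 - a) * (1 - b)) - 1) = y * (a / (1 - a) + b / (1 - b))"
      by simp
    then show ?thesis using that by (simp add: y_def algebra_simps)
  qed
  from this [of "qpoch d" "qpoch (2 * j + d)" "q ^ j\<^sup>2"] show ?thesis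
    unfolding e p a_def [symmetric] b_def [symmetric] by simp
qed

text \<open>
  Since \<open>(qpoch n)\<^sup>2 / (qpoch (n - j) * qpoch (n + j))\<close> tends to 1, the following is a truncation
  of the alternating theta series, chosen such that its dependence on \<open>n\<close> telescopes.
\<close>
definition gauss_sum :: "nat \<Rightarrow> complex" where
  "gauss_sum n = 1 / (qpoch n)\<^sup>2 + 2 * (\<Sum>j = 1..n. (- 1) ^ j * (q ^ j\<^sup>2 / (qpoch (n - j) * qpoch (n + j))))"

text \<open>The change of each summand has the form \<open>h j + h (Suc j)\<close>, so the
  alternating sum telescopes; the new summand j = n + 1 cancels the upper boundary term.\<close>

lemma gauss_sum_Suc: "(1 - q ^ (2 * n + 2)) * gauss_sum (Suc n) = gauss_sum n"
proof -
  define t where "t n j = q ^ j\<^sup>2 / (qpoch (n - j) * qpoch (n + j))" for n j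
  define c where "c = 1 - q ^ (2 * n + 2)"
  define h where "h j = q ^ j\<^sup>2 * q ^ (Suc n - j) / (qpoch (Suc n - j) * qpoch (n + j))" for j
  have h: "c * t (Suc n) j - t n j = h j + h (Suc j)" if j: "j \<le> n" for j
  proof -
    obtain d where d: "n = j + d" using le_Suc_ex [OF j] by blast
    have "j\<^sup>2 + (2 * j + d + 1) = (Suc j)\<^sup>2 + d" by (simp add: power2_eq_square)
    then have e: "q ^ j\<^sup>2 * q ^ (2 * j + d + 1) = q ^ (Suc j)\<^sup>2 * q ^ d" by (metis power_add)
    have i: "Suc (j + d) - j = d + 1" "j + d - j = d" "Suc (j + d) - Suc j = d"
      "Suc (j + d) + j = 2 * j + d + 1" "j + d + j = 2 * j + d" "j + d + Suc j = 2 * j + d + 1"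
      by simp_all
    show ?thesis
      using gauss_summand [of j d] unfolding c_def t_def h_def d i e .
  qed
  have tele: "(\<Sum>j = 1..m. (- 1) ^ j * (h j + h (Suc j))) = - h 1 + (- 1) ^ m * h (Suc m)" for m
    by (induction m) (simp_all add: algebra_simps)
  have top: "c * t (Suc n) (Suc n) = h (Suc n)"
  proof -
    have i: "Suc n - Suc n = 0" "Suc n + Suc n = Suc (2 * n + 1)" "n + Suc n = 2 * n + 1" "Suc (2 * n + 1) = 2 * n + 2"
      by simp_all
    have p: "qpoch (2 * n + 2) = qpoch (2 * n + 1) * c"
      using qpoch_Suc [of "2 * n + 1"] by (simp add: c_def)
    have "c \<noteq> 0" unfolding c_def by (rule one_minus_power_nonzero) simp
    then show ?thesis
      unfolding t_def h_def i p by simp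
  qed
  \<comment> \<open>The summand j = 0, which is not doubled, thus changes by \<open>2 * h 1\<close>
    and cancels the lower boundary term.\<close>
  have "h 0 = h 1" by (simp add: h_def)
  have split: "gauss_sum m = t m 0 + 2 * (\<Sum>j = 1..m. (- 1) ^ j * t m j)" for m
    by (simp add: gauss_sum_def t_def power2_eq_square)
  have "c * gauss_sum (Suc n) - gauss_sum n =
     (c * t (Suc n) 0 - t n 0) + 2 * (\<Sum>j = 1..n. (- 1) ^ j * (c * t (Suc n) j - t n j)) + 2 * (- 1) ^ Suc n * (c * t (Suc n) (Suc n))"
    by (simp add: split sum_subtractf sum_distrib_left algebra_simps)
  also have "(\<Sum>j = 1..n. (- 1) ^ j * (c * t (Suc n) j - t n j)) = - h 1 + (- 1) ^ n * h (Suc n)"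
    unfolding tele [symmetric] using h by (intro sum.cong) auto
  also have "c * t (Suc n) 0 - t n 0 = 2 * h 1"
    using h [of 0] \<open>h 0 = h 1\<close> by simp
  finally have "c * gauss_sum (Suc n) - gauss_sum n = 0" unfolding top by simp
  then show ?thesis by (simp add: c_def)
qed

text \<open>A finite form of Gauss's identity: with y = q^(n+1), each step multiplies by (1 - y)^2 /
  (1 - y^2).\<close>

lemma gauss_sum_eq: "(qpoch n)\<^sup>2 * gauss_sum n = (\<Prod>k<n. (1 - q ^ Suc k) / (1 + q ^ Suc k))"
proof (induction n)
  case 0
  then show ?case by (simp add: gauss_sum_def)
next
  case (Suc n)
  define y where "y = q ^ Suc n"
  have y: "q ^ (2 * n + 2) = y * y" by (simp add: y_def mult_2 power_add)
  have ny: "1 - y * y \<noteq> 0" using one_minus_power_nonzero [of "2 * n + 2"] y by simp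
  then have y1: "1 + y \<noteq> 0" "1 - y \<noteq> 0" by (auto simp: algebra_simps add_eq_0_iff)
  have fac: "1 - y * y = (1 - y) * (1 + y)" by (simp add: algebra_simps)
  have "gauss_sum (Suc n) = gauss_sum n / ((1 - y) * (1 + y))"
    using gauss_sum_Suc [of n] ny unfolding y fac by (simp add: field_simps)
  then have "(qpoch (Suc n))\<^sup>2 * gauss_sum (Suc n) = ((qpoch n)\<^sup>2 * gauss_sum n) * ((1 - y)\<^sup>2 / ((1 - y) * (1 + y)))"
    by (simp add: qpoch_Suc y_def power_mult_distrib)
  also have "(1 - y)\<^sup>2 / ((1 - y) * (1 + y)) = (1 - y) / (1 + y)"
    using y1 by (simp add: power2_eq_square)
  finally show ?case using Suc.IH by (simp add: y_def)
qed

section \<open>Passage to the limit in the finite product identity\<close>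

lemma euler_prod:
  assumes "norm w \<le> 1"
  shows "euler w = (\<Prod>k<n. 1 - q ^ Suc k * w) * euler (q ^ n * w)"
proof (induction n)
  case (Suc n)
  have "norm (q ^ n * w) \<le> 1"
    using q assms by (simp add: norm_mult norm_power mult_le_one power_le_one)
  then have "norm (q ^ n * w) < 1 / norm q" using one_less_inverse by linarith
  from euler_shift [OF this] Suc.IH show ?case by (simp add: mult_ac)
qed simp

text \<open>The remaining factor \<open>euler (q ^ n * w)\<close> tends to
  \<open>euler 0 = 1\<close> by continuity.\<close>

lemma euler_prod_tendsto:
  assumes "norm w \<le> 1"
  shows "(\<lambda>n. \<Prod>k<n. 1 - q ^ Suc k * w) \<longlonglongrightarrow> euler w"
proof -
  have "(\<lambda>n. q ^ n) \<longlonglongrightarrow> 0" using q by (intro LIMSEQ_power_zero)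
  then have "(\<lambda>n. q ^ n * w) \<longlonglongrightarrow> 0" by (intro tendsto_mult_left_zero)
  moreover have "isCont euler 0"
    using continuous_on_interior [OF holomorphic_on_imp_continuous_on [OF euler_holomorphic], of 0] q by simp
  ultimately have "(\<lambda>n. euler (q ^ n * w)) \<longlonglongrightarrow> 1"
    using isCont_tendsto_compose [of 0 euler] by fastforce
  then have "(\<lambda>n. euler w / euler (q ^ n * w)) \<longlonglongrightarrow> euler w / 1"
    by (intro tendsto_intros) auto
  moreover have "euler w / euler (q ^ n * w) = (\<Prod>k<n. 1 - q ^ Suc k * w)" for n
    using euler_prod [OF assms, of n] by (simp add: field_simps)
  ultimately show ?thesis by simp
qed

lemma power_square_le: "norm (q ^ (Suc j)\<^sup>2) \<le> norm q ^ j"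
proof -
  have "j \<le> (Suc j)\<^sup>2" by (simp add: power2_eq_square)
  then show ?thesis using q by (simp add: norm_power power_decreasing)
qed

text \<open>Tannery's theorem lets n tend to infinity in \<open>gauss_sum_eq\<close>. Since
  \<open>qpoch\<close> has a nonzero limit, it and its inverse are bounded, which yields a geometric
  majorant.\<close>

lemma gauss_theta: "euler 1 / euler (- 1) = 1 + 2 * (\<Sum>j. (- 1) ^ Suc j * q ^ (Suc j)\<^sup>2)"
proof -
  define e where "e = euler 1"
  have e: "qpoch \<longlonglongrightarrow> e" "e \<noteq> 0"
    using euler_prod_tendsto [of 1] by (simp_all add: qpoch_def [abs_def] e_def)
  have einv: "(\<lambda>n. inverse (qpoch n)) \<longlonglongrightarrow> inverse e" using e by (intro tendsto_inverse)
  obtain C where C: "norm (qpoch n) \<le> C" for n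
    using convergent_imp_Bseq [OF convergentI [OF e(1)]] by (auto simp: Bseq_def)
  obtain C' where C': "norm (inverse (qpoch n)) \<le> C'" for n
    using convergent_imp_Bseq [OF convergentI [OF einv]] by (auto simp: Bseq_def)
  \<comment> \<open>The summand with index j + 1, extended by 0 beyond n so that the finite sum
    becomes a series; the guard also keeps the natural subtraction harmless.\<close>
  define a where "a j n = (if Suc j \<le> n then (- 1) ^ Suc j * q ^ (Suc j)\<^sup>2 * ((qpoch n)\<^sup>2 * (inverse (qpoch (n - Suc j)) * inverse (qpoch (n + Suc j)))) else 0)" for j n
  have C0: "0 \<le> C" "0 \<le> C'" using C C' norm_ge_zero order_trans by blast+
  have "norm (a j n) \<le> norm q ^ j * (C\<^sup>2 * (C' * C'))" for j n
  proof (cases "Suc j \<le> n")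
    case True
    then have "norm (a j n) = norm (q ^ (Suc j)\<^sup>2) * (norm (qpoch n) ^ 2 * (norm (inverse (qpoch (n - Suc j))) * norm (inverse (qpoch (n + Suc j)))))"
      by (simp add: a_def norm_mult norm_power del: power_Suc)
    also have "\<dots> \<le> norm q ^ j * (C\<^sup>2 * (C' * C'))"
      by (intro mult_mono power_mono power_square_le C C' mult_nonneg_nonneg) (use C0 in auto)
    finally show ?thesis .
  qed (use C0 in \<open>simp add: a_def\<close>)
  then have bound: "eventually (\<lambda>(j, n). norm (a j n) \<le> norm q ^ j * (C\<^sup>2 * (C' * C'))) (at_top \<times>\<^sub>F sequentially)"
    by (intro always_eventually) auto
  have lim: "a j \<longlonglongrightarrow> (- 1) ^ Suc j * q ^ (Suc j)\<^sup>2" for j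
  proof -
    have "(\<lambda>n. (- 1) ^ Suc j * q ^ (Suc j)\<^sup>2 * ((qpoch n)\<^sup>2 * (inverse (qpoch (n - Suc j)) * inverse (qpoch (n + Suc j)))))
        \<longlonglongrightarrow> (- 1) ^ Suc j * q ^ (Suc j)\<^sup>2 * (e\<^sup>2 * (inverse e * inverse e))"
      by (intro tendsto_intros e einv [THEN LIMSEQ_ignore_initial_segment])
         (rule LIMSEQ_offset [of _ "Suc j"], use e in simp_all)
    moreover have "\<forall>\<^sub>F n in sequentially. (- 1) ^ Suc j * q ^ (Suc j)\<^sup>2 * ((qpoch n)\<^sup>2 * (inverse (qpoch (n - Suc j)) * inverse (qpoch (n + Suc j)))) = a j n"
      using eventually_ge_at_top [of "Suc j"] by eventually_elim (simp add: a_def)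
    ultimately show ?thesis
      using e(2) by (subst (asm) tendsto_cong) (auto simp: power2_eq_square field_simps)
  qed
  have sm: "summable (\<lambda>j. norm q ^ j * (C\<^sup>2 * (C' * C')))"
    using q by (intro summable_mult2 summable_geometric) auto
  have "(\<lambda>n. \<Sum>j. a j n) \<longlonglongrightarrow> (\<Sum>j. (- 1) ^ Suc j * q ^ (Suc j)\<^sup>2)"
    using tannerys_theorem [OF lim bound sm] by simp
  then have "(\<lambda>n. 1 + 2 * (\<Sum>j. a j n)) \<longlonglongrightarrow> 1 + 2 * (\<Sum>j. (- 1) ^ Suc j * q ^ (Suc j)\<^sup>2)"
    by (intro tendsto_intros)
  moreover have "1 + 2 * (\<Sum>j. a j n) = (\<Prod>k<n. 1 - q ^ Suc k * 1) / (\<Prod>k<n. 1 - q ^ Suc k * (- 1))" for n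
  proof -
    have "(\<Sum>j. a j n) = (\<Sum>j<n. a j n)"
      by (rule suminf_finite) (auto simp: a_def)
    also have "\<dots> = (\<Sum>j<n. (qpoch n)\<^sup>2 * ((- 1) ^ Suc j * (q ^ (Suc j)\<^sup>2 / (qpoch (n - Suc j) * qpoch (n + Suc j)))))"
      by (intro sum.cong) (auto simp: a_def field_simps)
    also have "\<dots> = (\<Sum>j = 1..n. (qpoch n)\<^sup>2 * ((- 1) ^ j * (q ^ j\<^sup>2 / (qpoch (n - j) * qpoch (n + j)))))"
      by (rule sum.reindex_bij_witness [of _ "\<lambda>j. j - 1" Suc]) auto
    also have "\<dots> = (qpoch n)\<^sup>2 * (\<Sum>j = 1..n. (- 1) ^ j * (q ^ j\<^sup>2 / (qpoch (n - j) * qpoch (n + j))))"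
      by (simp only: sum_distrib_left)
    finally have "1 + 2 * (\<Sum>j. a j n) = (qpoch n)\<^sup>2 * gauss_sum n"
      by (simp add: gauss_sum_def distrib_left)
    then show ?thesis by (simp add: gauss_sum_eq prod_dividef)
  qed
  moreover have "(\<lambda>n. (\<Prod>k<n. 1 - q ^ Suc k * 1) / (\<Prod>k<n. 1 - q ^ Suc k * (- 1))) \<longlonglongrightarrow> euler 1 / euler (- 1)"
    by (intro tendsto_divide euler_prod_tendsto) auto
  ultimately show ?thesis using LIMSEQ_unique by auto
qed

text \<open>Since j and j^2 have the same parity, (-q)^(j^2) = (-1)^j q^(j^2). Positive and negative
  j contribute equally, which is the factor 2 in \<open>gauss_theta\<close>.\<close>

lemma theta3_0_minus: "theta3_0 (- q) = euler 1 / euler (- 1)"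
proof -
  define f :: "int \<Rightarrow> complex" where "f j = (- q) ^ nat (j\<^sup>2)" for j
  define S where "S = (\<Sum>j. (- 1) ^ Suc j * q ^ (Suc j)\<^sup>2)"
  have fS: "f (int (Suc j)) = (- 1) ^ Suc j * q ^ (Suc j)\<^sup>2" for j
  proof -
    have "f (int (Suc j)) = (- q) ^ (Suc j)\<^sup>2"
      unfolding f_def by (metis nat_int of_nat_power)
    then show ?thesis by (cases "even j") (auto simp: even_power)
  qed
  have sym: "f (- j) = f j" for j by (simp add: f_def)
  have "norm (norm (f (int (Suc j)))) \<le> norm q ^ j" for j
    unfolding fS using power_square_le [of j] by (simp add: norm_mult norm_power)
  then have "summable (\<lambda>j. norm (f (int (Suc j))))"
    using q by (intro summable_comparison_test' [OF summable_geometric, of "norm q" 0]) auto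
  moreover have "(\<lambda>j. f (int (Suc j))) sums S"
    using summable_norm_cancel [OF calculation] unfolding S_def fS by (rule summable_sums)
  ultimately have p: "((\<lambda>j. f (int (Suc j))) has_sum S) UNIV"
    by (rule norm_summable_imp_has_sum)
  have P: "(f has_sum S) (range (\<lambda>j. int (Suc j)))"
    using p by (subst has_sum_reindex) (auto simp: inj_on_def o_def)
  have N: "(f has_sum S) (range (\<lambda>j. - int (Suc j)))"
    using p by (subst has_sum_reindex) (auto simp: inj_on_def o_def sym [of "int _"] simp del: of_nat_Suc)
  have "(f has_sum (S + S)) (range (\<lambda>j. int (Suc j)) \<union> range (\<lambda>j. - int (Suc j)))"
    by (rule has_sum_Un_disjoint [OF P N]) auto
  then have "(f has_sum (f 0 + (S + S))) (insert 0 (range (\<lambda>j. int (Suc j)) \<union> range (\<lambda>j. - int (Suc j))))"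
    by (intro has_sum_insert) auto
  moreover have "insert 0 (range (\<lambda>j. int (Suc j)) \<union> range (\<lambda>j. - int (Suc j))) = UNIV"
  proof -
    have "j \<in> insert 0 (range (\<lambda>j. int (Suc j)) \<union> range (\<lambda>j. - int (Suc j)))" for j
      by (cases j rule: int_cases3) (auto simp: image_iff intro: gr0_implies_Suc dest!: gr0_implies_Suc)
    then show ?thesis by blast
  qed
  ultimately have "(f has_sum (1 + (S + S))) UNIV" by (simp add: f_def)
  then show ?thesis
    unfolding theta3_0_def gauss_theta f_def [abs_def] S_def by (simp add: infsumI)
qed

end
section \<open>Bernoulli numbers\<close>

text \<open>Coefficient comparison in t / (e^t - 1) - 2t / (e^(2t) - 1) = t / (e^t + 1);
  \<open>B2\<close> is \<open>B\<close> at 2t.\<close>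

lemma fps_logistic:
  fixes B :: "'a::field_char_0 fps"
  defines "B \<equiv> fps_X / (fps_exp 1 - 1)"
  shows "fps_nth (inverse (1 + fps_exp 1)) n = (1 - 2 ^ Suc n) * fps_nth B (Suc n)"
proof -
  define e where "e = (fps_exp 1 :: 'a fps)"
  define B2 where "B2 = fps_compose B (fps_const 2 * fps_X)"
  have "fps_nth (e - 1) 1 \<noteq> 0" by (simp add: e_def)
  then have e0: "e - 1 \<noteq> 0" by (metis fps_zero_nth)
  have "subdegree (e - 1) \<le> subdegree (fps_X :: 'a fps)"
    using \<open>fps_nth (e - 1) 1 \<noteq> 0\<close> by (simp add: subdegree_leI)
  then have BE: "B * (e - 1) = fps_X"
    unfolding B_def e_def [symmetric] using e0 by (simp add: fps_divide_times_eq fps_dvd_iff)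
  have "fps_compose (B * (e - 1)) (fps_const 2 * fps_X) = B2 * fps_compose (e - 1) (fps_const 2 * fps_X)"
    unfolding B2_def by (rule fps_compose_mult_distrib) simp
  then have "B2 * fps_compose (e - 1) (fps_const 2 * fps_X) = fps_compose fps_X (fps_const 2 * fps_X)"
    unfolding BE by simp
  also have "fps_compose fps_X (fps_const 2 * fps_X) = fps_const 2 * (fps_X :: 'a fps)"
    by (rule fps_X_fps_compose_startby0) simp
  also have "fps_compose (e - 1) (fps_const 2 * fps_X) = (e - 1) * (e + 1)"
  proof -
    have "fps_compose e (fps_const 2 * fps_X) = e * e"
      unfolding e_def fps_exp_compose_linear using fps_exp_add_mult [of 1 "1::'a"] by simp
    then show ?thesis by (simp add: fps_compose_sub_distrib algebra_simps)
  qed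
  finally have B2E: "B2 * (e - 1) * (e + 1) = fps_const 2 * fps_X"
    by (simp only: mult.assoc)
  have "((B - B2) * (1 + e)) * (e - 1) = (1 + e) * (B * (e - 1)) - B2 * (e - 1) * (e + 1)"
    by (simp add: algebra_simps)
  also have "\<dots> = fps_X * (e - 1)"
    unfolding BE B2E by (simp add: algebra_simps flip: fps_numeral_fps_const)
  finally have "(B - B2) * (1 + e) = fps_X"
    using e0 by simp
  moreover have "fps_nth (1 + e) 0 \<noteq> 0" by (simp add: e_def)
  then have "(1 + e) * inverse (1 + e) = 1" by (rule inverse_mult_eq_1')
  ultimately have "B - B2 = fps_X * inverse (1 + e)"
    by (metis mult.assoc mult.right_neutral)
  then have "fps_nth (B - B2) (Suc n) = fps_nth (inverse (1 + e)) n" by simp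
  moreover have "fps_nth B2 (Suc n) = 2 ^ Suc n * fps_nth B (Suc n)"
    unfolding B2_def fps_compose_linear by simp
  ultimately show ?thesis by (simp add: e_def algebra_simps)
qed

text \<open>This serves twice: it gives the Riccati equation behind the signs of the Bernoulli
  numbers, and it turns the polar part of \<open>wp\<close>, seen from the half period, into a
  derivative.\<close>

lemma fps_deriv_logistic:
  fixes U :: "'a::field_char_0 fps"
  defines "U \<equiv> inverse (1 + fps_exp 1)"
  shows "fps_deriv U = U\<^sup>2 - U"
proof -
  have "fps_nth (1 + fps_exp 1 :: 'a fps) 0 \<noteq> 0" by simp
  then have 1: "(1 + fps_exp 1) * U = 1" unfolding U_def by (rule inverse_mult_eq_1')
  then have "fps_deriv ((1 + fps_exp 1) * U) = 0" by simp
  then have 2: "fps_exp 1 * U + (1 + fps_exp 1) * fps_deriv U = 0" by (simp add: algebra_simps)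
  have "U * (fps_exp 1 * U) = U - U\<^sup>2"
    using arg_cong [OF 1, of "\<lambda>x. U * x"] by (simp add: algebra_simps power2_eq_square)
  moreover have "fps_deriv U = (1 + fps_exp 1) * U * fps_deriv U" by (simp add: 1)
  moreover have "\<dots> = U * ((1 + fps_exp 1) * fps_deriv U)" by (simp only: mult_ac)
  moreover have "(1 + fps_exp 1) * fps_deriv U = - (fps_exp 1 * U)"
    using 2 by (simp add: add_eq_0_iff)
  ultimately show ?thesis by simp
qed

text \<open>The sign pattern is that of the coefficients of \<open>- tanh (x / 2) / 2\<close>.\<close>
lemma riccati_sign:
  fixes V :: "real fps"
  assumes V0: "fps_nth V 0 = 0" and ode: "fps_deriv V = V\<^sup>2 - fps_const (1 / 4)"
  shows "(even n \<longrightarrow> fps_nth V n = 0) \<and> (odd n \<longrightarrow> 0 \<le> (- 1) ^ Suc (n div 2) * fps_nth V n)"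
proof (induction n rule: less_induct)
  case (less n)
  show ?case
  proof (cases n)
    case 0
    then show ?thesis using V0 by simp
  next
    case (Suc m)
    have "real (Suc m) * fps_nth V (Suc m) = fps_nth (fps_deriv V) m" by simp
    also have "\<dots> = (\<Sum>i = 0..m. fps_nth V i * fps_nth V (m - i)) - (if m = 0 then 1 / 4 else 0)"
      unfolding ode by (simp add: power2_eq_square fps_mult_nth)
    finally have rec: "real (Suc m) * fps_nth V (Suc m) = \<dots>" .
    show ?thesis
    proof (cases "even m")
      case False
      have "fps_nth V i * fps_nth V (m - i) = 0" if "i \<le> m" for i
      proof -
        have "even i \<or> even (m - i)" using False that by auto
        moreover have "i < n" "m - i < n" using that Suc by auto
        ultimately show ?thesis using less.IH [of i] less.IH [of "m - i"] by auto
      qed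
      then have "real (Suc m) * fps_nth V (Suc m) = 0"
        using False unfolding rec by (auto intro!: sum.neutral)
      then show ?thesis using Suc False by auto
    next
      case True
      have "0 \<le> (- 1) ^ Suc (m div 2) * (fps_nth V i * fps_nth V (m - i))" if "i \<le> m" for i
      proof (cases "even i")
        case True
        then show ?thesis using less.IH [of i] that Suc by auto
      next
        case False
        then have o: "odd (m - i)" using \<open>even m\<close> that by auto
        \<comment> \<open>Both halves are rounded down, hence the \<open>Suc\<close>; it makes the
          sign exponent for m the sum of those for i and m - i.\<close>
        from False o have "m div 2 = Suc (i div 2 + (m - i) div 2)"
          using that by (auto elim!: oddE)
        then have "(- 1) ^ Suc (m div 2) * (fps_nth V i * fps_nth V (m - i)) =
            ((- 1) ^ Suc (i div 2) * fps_nth V i) * ((- 1) ^ Suc ((m - i) div 2) * fps_nth V (m - i))"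
          by (simp add: power_add)
        moreover have "0 \<le> (- 1) ^ Suc (i div 2) * fps_nth V i" "0 \<le> (- 1) ^ Suc ((m - i) div 2) * fps_nth V (m - i)"
          using less.IH [of i] less.IH [of "m - i"] that Suc False o by auto
        ultimately show ?thesis by (metis mult_nonneg_nonneg)
      qed
      then have "0 \<le> (\<Sum>i = 0..m. (- 1) ^ Suc (m div 2) * (fps_nth V i * fps_nth V (m - i)))"
        by (intro sum_nonneg) auto
      moreover have "real (Suc m) * ((- 1) ^ Suc (m div 2) * fps_nth V (Suc m)) =
          (\<Sum>i = 0..m. (- 1) ^ Suc (m div 2) * (fps_nth V i * fps_nth V (m - i))) - (- 1) ^ Suc (m div 2) * (if m = 0 then 1 / 4 else 0)"
        using arg_cong [OF rec, of "\<lambda>x. (- 1) ^ Suc (m div 2) * x"]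
        by (simp only: right_diff_distrib sum_distrib_left mult_ac)
      moreover have "(- 1) ^ Suc (m div 2) * (if m = 0 then 1 / 4 else 0) \<le> (0::real)" by simp
      ultimately have "0 \<le> real (Suc m) * ((- 1) ^ Suc (m div 2) * fps_nth V (Suc m))" by linarith
      then have "0 \<le> (- 1) ^ Suc (m div 2) * fps_nth V (Suc m)"
        by (simp only: zero_le_mult_iff) auto
      then show ?thesis using True Suc by simp
    qed
  qed
qed

text \<open>Subtracting the constant term 1/2 turns U' = U^2 - U into V' = V^2 - 1/4, so
  \<open>riccati_sign\<close> applies. The negative factor 1 - 2^(2k+2) from
  \<open>fps_logistic\<close> then reverses the sign.\<close>

lemma abs_bernoulli: "\<bar>bernoulli (2 * k + 2)\<bar> = (- 1) ^ k * bernoulli (2 * k + 2)"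
proof -
  define U where "U = (inverse (1 + fps_exp 1) :: real fps)"
  define V where "V = U - fps_const (1 / 2)"
  have "fps_nth V 0 = 0" by (simp add: V_def U_def)
  moreover have "fps_deriv V = V\<^sup>2 - fps_const (1 / 4)"
  proof -
    have "fps_deriv V = U\<^sup>2 - U"
      using fps_deriv_logistic unfolding V_def U_def by simp
    moreover have "2 * U * fps_const (1 / 2) = U"
      by (intro fps_ext) simp
    ultimately show ?thesis
      unfolding V_def power2_diff by (simp add: power_divide)
  qed
  ultimately have "0 \<le> (- 1) ^ Suc ((2 * k + 1) div 2) * fps_nth V (2 * k + 1)"
    using riccati_sign [of V "2 * k + 1"] by simp
  then have "0 \<le> (- 1) ^ Suc k * fps_nth U (2 * k + 1)" by (simp add: V_def)
  also have "fps_nth U (2 * k + 1) = (1 - 2 ^ (2 * k + 2)) * (bernoulli (2 * k + 2) / fact (2 * k + 2))"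
    unfolding U_def fps_logistic by (simp add: bernoulli_def del: fact_Suc)
  finally have "0 \<le> (2 ^ (2 * k + 2) - 1) / fact (2 * k + 2) * ((- 1) ^ k * bernoulli (2 * k + 2))"
    by (simp add: field_simps del: fact_Suc)
  moreover have "(0::real) < (2 ^ (2 * k + 2) - 1) / fact (2 * k + 2)"
  proof -
    have "(1::real) < 2 ^ (2 * k + 2)" by (intro one_less_power) auto
    then show ?thesis by (simp del: fact_Suc)
  qed
  ultimately have "0 \<le> (- 1) ^ k * bernoulli (2 * k + 2)"
    by (metis linorder_not_less mult_less_0_iff order_less_asym)
  then show ?thesis by (cases "even k") auto
qed

text \<open>Thus -2 a_k is the derivative of order 2k of U' at 0, with U = 1 / (1 + e^t). The sign
  in the definition of a_k cancels that of the Bernoulli number.\<close>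

lemma bernoulli_a_eq:
  "of_real (bernoulli_a k) = - (fact (2 * k) * of_nat (2 * k + 1) * fps_nth (inverse (1 + fps_exp 1)) (2 * k + 1) / 2 :: complex)"
proof -
  define b where "b = bernoulli (2 * k + 2)"
  have "fps_nth (fps_X / (fps_exp 1 - 1) :: complex fps) (2 * k + 2) = of_real (b / fact (2 * k + 2))"
    by (simp only: bernoulli_fps [symmetric] fps_nth_Abs_fps b_def)
  then have "fps_nth (inverse (1 + fps_exp 1) :: complex fps) (2 * k + 1) = (1 - 2 ^ (2 * k + 2)) * of_real (b / fact (2 * k + 2))"
    by (simp only: fps_logistic Suc_eq_plus1 add.assoc one_add_one)
  moreover have "fact (2 * k + 2) = (of_nat (2 * k + 2) * (of_nat (2 * k + 1) * fact (2 * k)) :: complex)"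
    by (simp add: algebra_simps)
  moreover have "of_nat (2 * k + 1) \<noteq> (0::complex)" "of_nat (2 * k + 2) \<noteq> (0::complex)"
    by (simp_all only: of_nat_eq_0_iff)
  ultimately have "fact (2 * k) * of_nat (2 * k + 1) * fps_nth (inverse (1 + fps_exp 1) :: complex fps) (2 * k + 1)
      = (1 - 2 ^ (2 * k + 2)) * of_real b / of_nat (2 * k + 2)"
    by (simp only: of_real_divide of_real_fact) (simp del: of_nat_add of_nat_mult of_nat_Suc)
  moreover have "bernoulli_a k = - ((1 - 2 ^ (2 * k + 2)) * b / real (2 * k + 2) / 2)"
  proof -
    have "bernoulli_a k = ((- 1) ^ k * (- 1) ^ k) * ((2 ^ (2 * k + 2) - 1) / (4 * (real k + 1))) * b"
      unfolding bernoulli_a_def abs_bernoulli b_def by (simp only: mult_ac)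
    also have "(- 1) ^ k * (- 1) ^ k = (1::real)" by (simp flip: power_mult_distrib)
    finally show ?thesis by (simp add: field_simps)
  qed
  ultimately show ?thesis by simp
qed

section \<open>Taylor expansion at the half period\<close>

lemma higher_deriv_sequence:
  fixes e :: "nat \<Rightarrow> complex \<Rightarrow> complex"
  assumes "open U" and "\<And>k z. z \<in> U \<Longrightarrow> (e k has_field_derivative e (Suc k) z) (at z)"
  shows "z \<in> U \<Longrightarrow> (deriv ^^ n) (e 0) z = e n z"
proof (induction n arbitrary: z)
  case (Suc n)
  have "eventually (\<lambda>x. (deriv ^^ n) (e 0) x = e n x) (nhds z)"
    using eventually_nhds_in_open [OF assms(1) Suc.prems] by eventually_elim (rule Suc.IH)
  then have "deriv ((deriv ^^ n) (e 0)) z = deriv (e n) z" by (intro deriv_cong_ev) auto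
  also have "\<dots> = e (Suc n) z" using assms(2) [OF Suc.prems] by (rule DERIV_imp_deriv)
  finally show ?case by simp
qed simp

context nome
begin

text \<open>The alternating sign is w^r at w = -1; dropping the zero term r = 0 matches the shifted
  index in \<open>lambert_G\<close>.\<close>

lemma lambert_minus_one: "lambert (\<lambda>r. of_nat r ^ Suc k) (- 1) = lambert_G (Suc k) q"
proof -
  have "summable (\<lambda>r. lambert_coeff (\<lambda>r. of_nat r ^ Suc k) r * (- 1) ^ r)"
    using one_less_inverse by (intro summable_lambert summable_power_powser) auto
  from suminf_split_head [OF this] show ?thesis
    by (simp add: lambert_def lambert_G_def Let_def lambert_coeff_def mult_ac)
qed

text \<open>F is the Taylor series of \<open>wp (- exp z) - wp (- 1)\<close> at z = 0. Its even
  coefficients split into a Bernoulli part from the polar term and a Lambert part from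
  \<open>eis\<close>.\<close>

lemma wp_taylor:
  obtains F \<beta> where "fps_nth F 0 = 0" "fps_nth F 1 = 0"
    "fps_deriv (fps_deriv F) = fps_const (theta3_0 (- q) ^ 8 / 8) + fps_const \<beta> * F + 6 * F\<^sup>2"
    "\<And>k. k \<ge> 1 \<Longrightarrow> fact (2 * k) * fps_nth F (2 * k) = 2 * lambert_g q k"
proof -
  define V where "V = {z. - exp z \<in> annulus - {1}}"
  have oV: "open V"
  proof -
    have "open ((\<lambda>z. - exp z) -` (annulus - {1}))"
      by (intro open_vimage continuous_intros open_Diff open_annulus)
    then show ?thesis by (simp add: V_def vimage_def)
  qed
  have V0: "0 \<in> V" by (simp add: V_def)
  note ev = eventually_nhds_in_open [OF oV V0]
  have chain: "((\<lambda>z. f (- exp z)) has_field_derivative f1 (- exp z)) (at z)"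
    if "\<And>w. w \<in> annulus \<Longrightarrow> w \<noteq> 1 \<Longrightarrow> (f has_field_derivative f1 w / w) (at w)" "z \<in> V" for f f1 z
  proof -
    have "((\<lambda>z. f (- exp z)) has_field_derivative f1 (- exp z) / (- exp z) * (- exp z)) (at z)"
      by (rule DERIV_chain2 [where g = "\<lambda>z. - exp z", OF that(1)])
         (use that(2) in \<open>auto simp: V_def intro!: derivative_eq_intros\<close>)
    then show ?thesis by simp
  qed
  define \<phi> where "\<phi> z = wp (- exp z) - wp (- 1)" for z
  define F where "F = fps_expansion \<phi> 0"
  have d1: "(\<phi> has_field_derivative wp1 (- exp z)) (at z)" if "z \<in> V" for z
    unfolding \<phi>_def [abs_def] using chain [OF wp_has_derivative that]
    by (auto intro!: derivative_eq_intros)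
  have d2: "((\<lambda>z. wp1 (- exp z)) has_field_derivative wp2 (- exp z)) (at z)" if "z \<in> V" for z
    using chain [OF wp1_has_derivative that] .
  have "\<phi> holomorphic_on V" using d1 oV by (auto simp: holomorphic_on_open)
  then have F: "\<phi> has_fps_expansion F"
    unfolding F_def by (rule has_fps_expansion_fps_expansion [OF oV V0])
  have "eventually (\<lambda>z. deriv \<phi> z = wp1 (- exp z)) (nhds 0)"
    using ev by eventually_elim (rule DERIV_imp_deriv [OF d1])
  then have F1: "(\<lambda>z. wp1 (- exp z)) has_fps_expansion fps_deriv F"
    using has_fps_expansion_deriv [OF F] by (subst (asm) has_fps_expansion_cong [OF _ refl]) auto
  have "eventually (\<lambda>z. deriv (\<lambda>z. wp1 (- exp z)) z = wp2 (- exp z)) (nhds 0)"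
    using ev by eventually_elim (rule DERIV_imp_deriv [OF d2])
  then have F2: "(\<lambda>z. wp2 (- exp z)) has_fps_expansion fps_deriv (fps_deriv F)"
    using has_fps_expansion_deriv [OF F1] by (subst (asm) has_fps_expansion_cong [OF _ refl]) auto
  have nth0: "fps_nth G 0 = g 0" if "g has_fps_expansion G" for g and G :: "complex fps"
    using fps_nth_fps_expansion [OF that, of 0] by simp
  have F_0: "fps_nth F 0 = 0" using nth0 [OF F] by (simp add: \<phi>_def)
  have "fps_nth (fps_deriv F) 0 = 0" using nth0 [OF F1] by (simp add: wp1_def)
  then have F_1: "fps_nth F 1 = 0" by simp
  obtain \<beta> \<gamma> where ode: "\<And>w. w \<in> annulus \<Longrightarrow> w \<noteq> 1 \<Longrightarrow> wp2 w = 6 * (wp w)\<^sup>2 + \<beta> * wp w + \<gamma>"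
    using wp_ode by blast
  \<comment> \<open>Recentring the quadratic equation at p replaces its constant term by
    \<open>wp2 (- 1)\<close>, so \<gamma> disappears.\<close>
  define p where "p = wp (- 1)"
  have wp2_1: "wp2 (- 1) = 6 * p\<^sup>2 + \<beta> * p + \<gamma>"
    unfolding p_def by (rule ode) auto
  have "(\<lambda>z. wp2 (- 1) + (12 * p + \<beta>) * \<phi> z + 6 * \<phi> z ^ 2) has_fps_expansion
      fps_const (wp2 (- 1)) + fps_const (12 * p + \<beta>) * F + 6 * F\<^sup>2"
    by (intro fps_expansion_intros F)
  moreover have "eventually (\<lambda>z. wp2 (- 1) + (12 * p + \<beta>) * \<phi> z + 6 * \<phi> z ^ 2 = wp2 (- exp z)) (nhds 0)"
    using ev
  proof eventually_elim
    case (elim z)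
    define x where "x = wp (- exp z)"
    have w: "wp2 (- exp z) = 6 * x\<^sup>2 + \<beta> * x + \<gamma>" using elim ode by (simp add: V_def x_def)
    have x: "\<phi> z = x - p" by (simp add: \<phi>_def x_def p_def)
    show ?case unfolding wp2_1 w x by (simp add: power2_eq_square algebra_simps)
  qed
  ultimately have "(\<lambda>z. wp2 (- exp z)) has_fps_expansion fps_const (wp2 (- 1)) + fps_const (12 * p + \<beta>) * F + 6 * F\<^sup>2"
    by (subst (asm) has_fps_expansion_cong [OF _ refl]) auto
  with F2 have "fps_deriv (fps_deriv F) = fps_const (wp2 (- 1)) + fps_const (12 * p + \<beta>) * F + 6 * F\<^sup>2"
    by (rule fps_expansion_unique_complex)
  then have ODE: "fps_deriv (fps_deriv F) = fps_const (theta3_0 (- q) ^ 8 / 8) + fps_const (12 * p + \<beta>) * F + 6 * F\<^sup>2"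
    by (simp add: wp2_minus_one theta3_0_minus)
  define U where "U = (inverse (1 + fps_exp 1) :: complex fps)"
  define e where "e k z = eis k (- exp z)" for k z
  have de: "(e k has_field_derivative e (Suc k) z) (at z)" if "z \<in> V" for k z
    unfolding e_def using chain [OF eis_has_derivative that] by simp
  define E where "E = fps_expansion (e 0) 0"
  have "e 0 holomorphic_on V" using de oV by (auto simp: holomorphic_on_open)
  then have E: "e 0 has_fps_expansion E"
    unfolding E_def by (rule has_fps_expansion_fps_expansion [OF oV V0])
  have E_nth: "fact n * fps_nth E n = eis n (- 1)" for n
    using fps_nth_fps_expansion [OF E, of n] higher_deriv_sequence [where e = e and U = V and n = n, OF oV de V0]
    by (simp add: e_def)
  have "(\<lambda>z. inverse (1 + exp z)) has_fps_expansion U"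
    unfolding U_def by (intro fps_expansion_intros) simp
  then have "(\<lambda>z. (inverse (1 + exp z))\<^sup>2 - inverse (1 + exp z) + e 0 z - wp (- 1)) has_fps_expansion
     U\<^sup>2 - U + E - fps_const (wp (- 1))"
    by (intro fps_expansion_intros E)
  moreover have "(inverse (1 + exp z))\<^sup>2 - inverse (1 + exp z) + e 0 z - wp (- 1) = \<phi> z" for z
  proof -
    \<comment> \<open>This is the polar term at w = -x. For 1 + x = 0 both sides are 0 by the
      division convention, so the equality of functions holds everywhere.\<close>
    have "(inverse (1 + x))\<^sup>2 - inverse (1 + x) = - x / (1 - (- x))\<^sup>2" for x :: complex
    proof (cases "1 + x = 0")
      case False
      then have "inverse (1 + x) = (1 + x) / (1 + x)\<^sup>2" by (simp add: power2_eq_square inverse_eq_divide)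
      moreover have "(inverse (1 + x))\<^sup>2 = 1 / (1 + x)\<^sup>2"
        by (simp add: inverse_eq_divide power_divide)
      ultimately have "(inverse (1 + x))\<^sup>2 - inverse (1 + x) = 1 / (1 + x)\<^sup>2 - (1 + x) / (1 + x)\<^sup>2"
        by simp
      then show ?thesis by (simp flip: diff_divide_distrib)
    qed simp
    then show ?thesis by (simp add: \<phi>_def wp_def e_def)
  qed
  ultimately have "\<phi> has_fps_expansion U\<^sup>2 - U + E - fps_const (wp (- 1))" by simp
  with F have F_eq: "F = U\<^sup>2 - U + E - fps_const (wp (- 1))"
    by (rule fps_expansion_unique_complex)
  also have "U\<^sup>2 - U = fps_deriv U" unfolding U_def by (rule fps_deriv_logistic [symmetric])
  finally have F_eq: "F = fps_deriv U + E - fps_const (wp (- 1))" .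
  have "fact (2 * k) * fps_nth F (2 * k) = 2 * lambert_g q k" if "k \<ge> 1" for k
  proof -
    have "fact (2 * k) * fps_nth F (2 * k) = fact (2 * k) * of_nat (2 * k + 1) * fps_nth U (2 * k + 1) + eis (2 * k) (- 1)"
      using that unfolding F_eq E_nth [symmetric] by (simp add: algebra_simps)
    also have "\<dots> = - 2 * of_real (bernoulli_a k) + eis (2 * k) (- 1)"
      unfolding bernoulli_a_eq U_def by simp
    also have "eis (2 * k) (- 1) = 2 * lambert_G (2 * k + 1) q"
      using lambert_minus_one [of "2 * k"] by (simp add: eis_def)
    finally show ?thesis by (simp add: lambert_g_def)
  qed
  with F_0 F_1 ODE show ?thesis using that by blast
qed

end

theorem theorem5p5:
  fixes q :: complex and n :: nat
  assumes "0 < norm q" and "norm q < 1" and "n \<ge> 1"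
  shows "theta3_0 (- q) ^ (4 * n * (n + 1)) =
           (2 ^ (2 * n\<^sup>2 + 3 * n) * (\<Prod>r = 1..2 * n. inverse (fact r))) *
           Determinant.det (Matrix.mat n n (\<lambda>(r, s). lambert_g q ((r + 1) + (s + 1) - 1)))"
proof -
  interpret nome q using assms by unfold_locales
  obtain F \<beta> where F0: "fps_nth F 0 = 0" "fps_nth F 1 = 0"
    and ode: "fps_deriv (fps_deriv F) = fps_const (theta3_0 (- q) ^ 8 / 8) + fps_const \<beta> * F + 6 * F\<^sup>2"
    and F: "\<And>k. k \<ge> 1 \<Longrightarrow> fact (2 * k) * fps_nth F (2 * k) = 2 * lambert_g q k"
    using wp_taylor by blast
  define T where "T = theta3_0 (- q)"
  \<comment> \<open>The constant term of F'' is 2c, so X = F / c satisfies the normalised equation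
    with leading constant 2 and quadratic coefficient 6c.\<close>
  define c where "c = T ^ 8 / 16"
  have c0: "c \<noteq> 0" by (simp add: c_def T_def theta3_0_minus)
  define X where "X = fps_const (1 / c) * F"
  define D where "D = Determinant.det (Matrix.mat n n (\<lambda>(r, s). lambert_g q ((r + 1) + (s + 1) - 1)))"
  have F_X: "F = fps_const c * X"
    using c0 by (simp add: X_def mult.assoc [symmetric])
  have "fps_deriv (fps_deriv X) = fps_const (1 / c) * (fps_const (2 * c) + fps_const \<beta> * F + 6 * F\<^sup>2)"
    using ode by (simp add: X_def c_def T_def)
  also have "\<dots> = 2 + fps_const (4 * (\<beta> / 4)) * X + fps_const (6 * c) * X\<^sup>2"
    unfolding F_X using c0
    by (intro fps_ext) (simp add: power2_eq_square algebra_simps numeral_fps_const)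
  finally have "fps_deriv (fps_deriv X) = 2 + fps_const (4 * (\<beta> / 4)) * X + fps_const (6 * c) * X\<^sup>2" .
  then have "Determinant.det (Matrix.mat n n (\<lambda>(i, j). fact (2 * (i + j + 1)) * fps_nth X (2 * (i + j + 1)))) =
      (\<Prod>r = 1..2 * n. fact r) * c ^ (n * (n - 1) div 2)"
    by (intro hankel_det_taylor [where b = "\<beta> / 4"]) (use F0 in \<open>auto simp: X_def\<close>)
  also have "Matrix.mat n n (\<lambda>(i, j). fact (2 * (i + j + 1)) * fps_nth X (2 * (i + j + 1))) =
      (2 / c) \<cdot>\<^sub>m Matrix.mat n n (\<lambda>(r, s). lambert_g q ((r + 1) + (s + 1) - 1))"
  proof -
    have "fact (2 * (i + j + 1)) * fps_nth X (2 * (i + j + 1)) = 2 / c * lambert_g q (i + j + 1)" for i j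
      using F [of "i + j + 1"] by (simp add: X_def del: fact_Suc mult_Suc_right)
    then show ?thesis by (intro eq_matI) auto
  qed
  finally have "(2 / c) ^ n * D = (\<Prod>r = 1..2 * n. fact r) * c ^ (n * (n - 1) div 2)"
    by (simp add: D_def)
  moreover have "(\<Prod>r = 1..2 * n. inverse (fact r)) = inverse (\<Prod>r = 1..2 * n. fact r :: complex)"
    by (rule prod_inversef [unfolded o_def])
  moreover have "(\<Prod>r = 1..2 * n. fact r :: complex) \<noteq> 0" by simp
  ultimately have "(\<Prod>r = 1..2 * n. inverse (fact r)) * ((2 / c) ^ n * D) = c ^ (n * (n - 1) div 2)"
    by (simp del: prod_zero_iff)
  moreover have "D = (c / 2) ^ n * ((2 / c) ^ n * D)"
    using c0 by (simp add: power_divide)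
  ultimately have *: "(\<Prod>r = 1..2 * n. inverse (fact r)) * D = (c / 2) ^ n * c ^ (n * (n - 1) div 2)"
    by (metis mult.left_commute)
  \<comment> \<open>On the right stands c^m / 2^n, and 2 n^2 + 3 n = 4 m + n; what remains is (16
    c)^m, an eighth power of theta to the m.\<close>
  define m where "m = n * (n + 1) div 2"
  have m2: "2 * m = n * (n + 1)" by (simp add: m_def)
  have "n * (n + 1) = n * (n - 1) + n * 2" by (cases n) simp_all
  then have m: "m = n * (n - 1) div 2 + n" by (simp add: m_def)
  have "2 * n\<^sup>2 + 3 * n = 4 * m + n"
    using m2 by (simp add: power2_eq_square algebra_simps)
  then have "2 ^ (2 * n\<^sup>2 + 3 * n) * ((c / 2) ^ n * c ^ (n * (n - 1) div 2)) = (2 ^ 4) ^ m * c ^ m"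
    by (simp only: m power_add power_mult power_divide) simp
  also have "\<dots> = (16 * c) ^ m" by (simp add: power_mult_distrib)
  also have "\<dots> = T ^ (8 * m)" by (simp add: c_def power_mult)
  also have "8 * m = 4 * n * (n + 1)" using m2 by simp
  finally show ?thesis
    unfolding mult.assoc D_def [symmetric] * T_def [symmetric] by (simp add: mult.assoc)
qed

end
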